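(* Let $(\omega_1,\omega_2,\omega_3)$ be an $\boldsymbol\varepsilon$-hypersymplectic structure on a Lie algebroid $(A,\rho,[\cdot,\cdot])$ such that $\varepsilon_1\varepsilon_2\varepsilon_3=1$, with inverse Poisson bivectors $\pi_i$, transition tensors $N_i$ and induced bivector $g^{-1}$. For all $i\in\{1,2,3\}$, the pairs $(\pi_i,N_i)$ and $(g^{-1},N_i)$ are Poisson–Nijenhuis ($PN$) structures on $A$.
   Context: Let $\mathrm d$ denote the differential of the Lie algebroid. For a $2$-form $\omega\in\Gamma(\bigwedge^2A^* )$, $\langle\omega^\flat(X),Y\rangle=\omega(X,Y)$; for a bivector $\pi\in\Gamma(\bigwedge^2A)$, $\langle\beta,\pi^\sharp(\alpha)\rangle=\pi(\alpha,\beta)$. A symplectic form is a closed non-degenerate $2$-form; its inverse Poisson bivector $\pi$ satisfies $\omega^\flat\circ\pi^\sharp=\mathrm{Id}_{A^*}$, $\pi^\sharp\circ\omega^\flat=\mathrm{Id}_A$. All indices are in $\mathbb{Z}_3=\{1,2,3\}$. Given symplectic forms $\omega_1,\omega_2,\omega_3$ with inverses $\pi_1,\pi_2,\pi_3$, the transition tensors are $N_i:=\pi_{i-1}^\sharp\circ\omega_{i+1}^\flat$. The triple is an $\boldsymbol\varepsilon$-hypersymplectic structure, $\boldsymbol\varepsilon=(\varepsilon_1,\varepsilon_2,\varepsilon_3)$ with $\varepsilon_i=\pm1$, if $N_i^2=\varepsilon_i\mathrm{Id}_A$ for $i=1,2,3$. The induced tensor $g\in\Gamma(\bigotimes^2A^*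 )$ is $g(X,Y)=\langle g^\flat X,Y\rangle$ with $g^\flat:=\varepsilon_3\varepsilon_2\,\omega_3^\flat\circ\pi_1^\sharp\circ\omega_2^\flat$, and $g^{-1}(\alpha,\beta):=\langle(g^\flat)^{-1}(\alpha),\beta\rangle$; when $\varepsilon_1\varepsilon_2\varepsilon_3=1$, $g$ is a $2$-form and $g^{-1}$ a bivector. For a bundle endomorphism $N$ of $A$ with transpose $N^*$: $[X,Y]_N=[NX,Y]+[X,NY]-N[X,Y]$ and $\mathcal TN(X,Y)=[NX,NY]-N[X,Y]_N$. For a bivector $\pi$, $[\alpha,\beta]_\pi=\mathcal L_{\pi^\sharp\alpha}\beta-\mathcal L_{\pi^\sharp\beta}\alpha-\mathrm d(\pi(\alpha,\beta))$ on $\Gamma(A^* )$, where $\mathcal L$ is the Lie derivative of the Lie algebroid. The Magri–Morosi concomitant is $C_{\pi,N}(\alpha,\beta)=([\alpha,\beta]_N)_\pi-([\alpha,\beta]_\pi)_{N^*}$, where $([\cdot,\cdot]_N)_\pi$ is the bracket on $\Gamma(A^* )$ obtained by the formula for $[\cdot,\cdot]_\pi$ applied to the deformed structure $(\rho\circ N,[\cdot,\cdot]_N)$ on $A$, and $([\alpha,\beta]_\pi)_{N^*}=[N^*\alpha,\beta]_\pi+[\alpha,N^*\beta]_\pi-N^*[\alpha,\beta]_\pi$. $(\pi,N)$ is a $PN$ structure if $[\pi,\pi]=0$ (Schouten–Nijenhuis bracket), $\mathcal TN=0$, $N\circ\pi^\sharp=\pi^\sharp\circ N^*$ and $C_{\pi,N}=0$.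 *)

theory Defs
  imports "HOL-Analysis.Analysis"
begin

section \<open>Smooth manifolds\<close>

text \<open>
  Model spaces (of manifolds and of fibres) range over finite-dimensional real normed spaces, and not
  over the class \<open>euclidean_space\<close>, in order to allow dimension 0.  In particular the base may be a
  point, so that Lie algebras are Lie algebroids, and bundles of rank 0 are included.
\<close>

definition finite_dim :: "'e::real_normed_vector itself \<Rightarrow> bool" where
  "finite_dim _ \<longleftrightarrow> (\<exists>B::'e set. finite B \<and> span B = UNIV)"

text \<open>\<open>Ck_on k U f\<close> is only used for open \<open>U\<close>: all iterated directional derivatives of \<open>f\<close> of order
  below \<open>k\<close> are differentiable on \<open>U\<close>, and those of order \<open>k\<close> are continuous.\<close>

primrec Ck_on :: "nat \<Rightarrow> 'e::real_normed_vector set \<Rightarrow> ('e \<Rightarrow> 'f::real_normed_vector) \<Rightarrow> bool" where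
  "Ck_on 0 U f \<longleftrightarrow> continuous_on U f"
| "Ck_on (Suc k) U f \<longleftrightarrow>
     f differentiable_on U \<and> (\<forall>v. Ck_on k U (\<lambda>x. frechet_derivative f (at x) v))"

definition smooth_on :: "'e::real_normed_vector set \<Rightarrow> ('e \<Rightarrow> 'f::real_normed_vector) \<Rightarrow> bool" where
  "smooth_on U f \<longleftrightarrow> (\<forall>k. Ck_on k U f)"

text \<open>Smoothness, read in the charts, of a map defined on an open subset \<open>W\<close> of a manifold.\<close>

definition mfd_smooth_on ::
  "('m set \<times> ('m \<Rightarrow> 'e::real_normed_vector)) set \<Rightarrow> 'm set \<Rightarrow> ('m \<Rightarrow> 'g::real_normed_vector) \<Rightarrow> bool"
where
  "mfd_smooth_on \<A> W f \<longleftrightarrow> (\<forall>(U, \<phi>)\<in>\<A>. smooth_on (\<phi> ` (U \<inter> W)) (f \<circ> inv_into U \<phi>))"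

text \<open>The manifold is the whole (Hausdorff, second countable) type \<open>'m\<close>; the last conjunct says that
  the transition maps between charts are smooth.\<close>

definition smooth_manifold ::
  "('m::{t2_space,second_countable_topology} set \<times> ('m \<Rightarrow> 'e::real_normed_vector)) set \<Rightarrow> bool" where
  "smooth_manifold \<A> \<longleftrightarrow>
     finite_dim TYPE('e) \<and>
     (\<Union>(U, \<phi>)\<in>\<A>. U) = UNIV \<and>
     (\<forall>(U, \<phi>)\<in>\<A>. open U \<and> open (\<phi> ` U) \<and> homeomorphism U (\<phi> ` U) \<phi> (inv_into U \<phi>)) \<and>
     (\<forall>(U, \<phi>)\<in>\<A>. mfd_smooth_on \<A> U \<phi>)"


section \<open>Vector bundles\<close>

definition linear_on_set ::
  "'v::real_vector set \<Rightarrow> ('v \<Rightarrow> 'w::real_vector) \<Rightarrow> bool" where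
  "linear_on_set S f \<longleftrightarrow>
     (\<forall>x\<in>S. \<forall>y\<in>S. f (x + y) = f x + f y) \<and> (\<forall>c. \<forall>x\<in>S. f (c *\<^sub>R x) = c *\<^sub>R f x)"

text \<open>
  The fibres are linear subspaces of an auxiliary real vector space \<open>'v\<close> that carries no topology.
  This is no restriction, since any family of vector spaces embeds fibrewise into, e.g., its direct
  sum; the smooth structure comes from the local trivializations \<open>(U, \<tau>)\<close> alone, where
  \<open>\<tau> m\<close> is a linear isomorphism from the fibre at \<open>m \<in> U\<close> onto the model fibre \<open>'f\<close>.
\<close>

record ('m, 'e, 'v, 'f) vector_bundle =
  charts :: "('m set \<times> ('m \<Rightarrow> 'e)) set"
  fibre :: "'m \<Rightarrow> 'v set"
  trivs :: "('m set \<times> ('m \<Rightarrow> 'v \<Rightarrow> 'f)) set"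

definition vector_bundle ::
  "('m::{t2_space,second_countable_topology}, 'e::real_normed_vector, 'v::real_vector,
    'f::real_normed_vector, 'z) vector_bundle_scheme \<Rightarrow> bool" where
  "vector_bundle A \<longleftrightarrow>
     smooth_manifold (charts A) \<and> finite_dim TYPE('f) \<and>
     (\<forall>m. subspace (fibre A m)) \<and>
     (\<Union>(U, \<tau>)\<in>trivs A. U) = UNIV \<and>
     (\<forall>(U, \<tau>)\<in>trivs A. open U \<and>
        (\<forall>m\<in>U. linear_on_set (fibre A m) (\<tau> m) \<and> bij_betw (\<tau> m) (fibre A m) UNIV)) \<and>
     (\<forall>(U, \<tau>)\<in>trivs A. \<forall>(V, \<sigma>)\<in>trivs A. \<forall>b.
        mfd_smooth_on (charts A) (U \<inter> V) (\<lambda>m. \<sigma> m (inv_into (fibre A m) (\<tau> m) b)))"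

definition smooth_funs ::
  "('m, 'e::real_normed_vector, 'v, 'f, 'z) vector_bundle_scheme \<Rightarrow> ('m \<Rightarrow> real) set" where
  "smooth_funs A = {f. mfd_smooth_on (charts A) UNIV f}"

definition sections ::
  "('m, 'e::real_normed_vector, 'v, 'f::real_normed_vector, 'z) vector_bundle_scheme
     \<Rightarrow> ('m \<Rightarrow> 'v) set" where
  "sections A = {X. (\<forall>m. X m \<in> fibre A m) \<and>
                    (\<forall>(U, \<tau>)\<in>trivs A. mfd_smooth_on (charts A) U (\<lambda>m. \<tau> m (X m)))}"


section \<open>Tensor fields\<close>

text \<open>
  All tensor fields are fields of tensors on the fibres.  Elements of the dual of a fibre are linear
  functionals on it, extended by 0 to \<open>'v\<close> so that equality of covectors is equality of functions.
\<close>

definition fibre_dual ::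
  "('m, 'e, 'v::real_vector, 'f, 'z) vector_bundle_scheme \<Rightarrow> 'm \<Rightarrow> ('v \<Rightarrow> real) set" where
  "fibre_dual A m = {\<xi>. linear_on_set (fibre A m) \<xi> \<and> (\<forall>v. v \<notin> fibre A m \<longrightarrow> \<xi> v = 0)}"

text \<open>A field of covectors (or of \<open>2\<close>-forms, or of endomorphisms) is smooth iff it takes smooth
  sections to smooth functions (or smooth sections).\<close>

definition one_forms ::
  "('m, 'e::real_normed_vector, 'v::real_vector, 'f::real_normed_vector, 'z) vector_bundle_scheme
     \<Rightarrow> ('m \<Rightarrow> 'v \<Rightarrow> real) set" where
  "one_forms A = {\<alpha>. (\<forall>m. \<alpha> m \<in> fibre_dual A m) \<and>
                     (\<forall>X\<in>sections A. (\<lambda>m. \<alpha> m (X m)) \<in> smooth_funs A)}"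

definition two_forms ::
  "('m, 'e::real_normed_vector, 'v::real_vector, 'f::real_normed_vector, 'z) vector_bundle_scheme
     \<Rightarrow> ('m \<Rightarrow> 'v \<Rightarrow> 'v \<Rightarrow> real) set" where
  "two_forms A = {\<omega>.
     (\<forall>m. \<forall>v\<in>fibre A m. linear_on_set (fibre A m) (\<omega> m v) \<and>
                           linear_on_set (fibre A m) (\<lambda>u. \<omega> m u v) \<and> \<omega> m v v = 0) \<and>
     (\<forall>X\<in>sections A. \<forall>Y\<in>sections A. (\<lambda>m. \<omega> m (X m) (Y m)) \<in> smooth_funs A)}"

definition endomorphisms ::
  "('m, 'e::real_normed_vector, 'v::real_vector, 'f::real_normed_vector, 'z) vector_bundle_scheme
     \<Rightarrow> ('m \<Rightarrow> 'v \<Rightarrow> 'v) set" where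
  "endomorphisms A = {N.
     (\<forall>m. linear_on_set (fibre A m) (N m) \<and> N m ` fibre A m \<subseteq> fibre A m) \<and>
     (\<forall>X\<in>sections A. (\<lambda>m. N m (X m)) \<in> sections A)}"

text \<open>
  Multivectors are regarded as alternating forms on the dual fibres, and bivector fields are the finite
  sums of wedge products of smooth sections: since the module of smooth sections is finitely generated
  and projective over the ring of smooth functions, these are all the smooth sections of
  \<open>\<And>\<^sup>2 A\<close>.  \<open>decomposes A P ps\<close> says that \<open>P\<close> is the sum of the \<open>X \<and> Y\<close> with \<open>(X, Y)\<close> in \<open>ps\<close>.
\<close>

definition decomposes ::
  "('m, 'e::real_normed_vector, 'v::real_vector, 'f::real_normed_vector, 'z) vector_bundle_scheme
     \<Rightarrow> ('m \<Rightarrow> ('v \<Rightarrow> real) \<Rightarrow> ('v \<Rightarrow> real) \<Rightarrow> real)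
     \<Rightarrow> (('m \<Rightarrow> 'v) \<times> ('m \<Rightarrow> 'v)) list \<Rightarrow> bool" where
  "decomposes A P ps \<longleftrightarrow>
     set ps \<subseteq> sections A \<times> sections A \<and>
     (\<forall>m. \<forall>\<xi>\<in>fibre_dual A m. \<forall>\<eta>\<in>fibre_dual A m.
        P m \<xi> \<eta> = (\<Sum>(X, Y)\<leftarrow>ps. \<xi> (X m) * \<eta> (Y m) - \<xi> (Y m) * \<eta> (X m)))"

definition bivector_fields ::
  "('m, 'e::real_normed_vector, 'v::real_vector, 'f::real_normed_vector, 'z) vector_bundle_scheme
     \<Rightarrow> ('m \<Rightarrow> ('v \<Rightarrow> real) \<Rightarrow> ('v \<Rightarrow> real) \<Rightarrow> real) set" where
  "bivector_fields A = {P. \<exists>ps. decomposes A P ps}"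

definition flat ::
  "('m, 'e, 'v, 'f, 'z) vector_bundle_scheme \<Rightarrow> ('m \<Rightarrow> 'v \<Rightarrow> 'v \<Rightarrow> real) \<Rightarrow> 'm \<Rightarrow> 'v \<Rightarrow> ('v \<Rightarrow> real)"
where
  "flat A \<omega> m v = (\<lambda>w. if w \<in> fibre A m then \<omega> m v w else 0)"

definition sharp ::
  "('m, 'e, 'v::real_vector, 'f, 'z) vector_bundle_scheme
     \<Rightarrow> ('m \<Rightarrow> ('v \<Rightarrow> real) \<Rightarrow> ('v \<Rightarrow> real) \<Rightarrow> real) \<Rightarrow> 'm \<Rightarrow> ('v \<Rightarrow> real) \<Rightarrow> 'v" where
  "sharp A P m \<xi> = (THE v. v \<in> fibre A m \<and> (\<forall>\<eta>\<in>fibre_dual A m. \<eta> v = P m \<xi> \<eta>))"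

definition transpose_endo ::
  "('m, 'e, 'v, 'f, 'z) vector_bundle_scheme
     \<Rightarrow> ('m \<Rightarrow> 'v \<Rightarrow> 'v) \<Rightarrow> 'm \<Rightarrow> ('v \<Rightarrow> real) \<Rightarrow> ('v \<Rightarrow> real)" where
  "transpose_endo A N m \<xi> = (\<lambda>v. if v \<in> fibre A m then \<xi> (N m v) else 0)"


section \<open>Lie algebroids\<close>

text \<open>
  Tangent vectors are point derivations of the algebra of smooth functions; \<open>anchor A m v\<close> is the
  tangent vector at \<open>m\<close> assigned to \<open>v\<close> in the fibre at \<open>m\<close>.  That the anchor intertwines the
  brackets is a consequence of the Jacobi identity and the Leibniz rule.
\<close>

record ('m, 'e, 'v, 'f) lie_algebroid = "('m, 'e, 'v, 'f) vector_bundle" +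
  bracket :: "('m \<Rightarrow> 'v) \<Rightarrow> ('m \<Rightarrow> 'v) \<Rightarrow> ('m \<Rightarrow> 'v)"
  anchor :: "'m \<Rightarrow> 'v \<Rightarrow> (('m \<Rightarrow> real) \<Rightarrow> real)"

definition point_derivation ::
  "('m, 'e::real_normed_vector, 'v, 'f, 'z) vector_bundle_scheme
     \<Rightarrow> 'm \<Rightarrow> (('m \<Rightarrow> real) \<Rightarrow> real) \<Rightarrow> bool" where
  "point_derivation A m D \<longleftrightarrow>
     (\<forall>f\<in>smooth_funs A. \<forall>g\<in>smooth_funs A.
        D (\<lambda>x. f x + g x) = D f + D g \<and> D (\<lambda>x. f x * g x) = D f * g m + f m * D g) \<and>
     (\<forall>f\<in>smooth_funs A. \<forall>c. D (\<lambda>x. c * f x) = c * D f)"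

text \<open>The derivative of the function \<open>f\<close> along the vector field \<open>\<rho>(X)\<close>.\<close>

definition anchor_deriv ::
  "('m, 'e, 'v, 'f, 'z) lie_algebroid_scheme \<Rightarrow> ('m \<Rightarrow> 'v) \<Rightarrow> ('m \<Rightarrow> real) \<Rightarrow> ('m \<Rightarrow> real)" where
  "anchor_deriv A X f = (\<lambda>m. anchor A m (X m) f)"

definition lie_algebroid ::
  "('m::{t2_space,second_countable_topology}, 'e::real_normed_vector, 'v::real_vector,
    'f::real_normed_vector, 'z) lie_algebroid_scheme \<Rightarrow> bool" where
  "lie_algebroid A \<longleftrightarrow>
     vector_bundle A \<and>
     (\<forall>m. \<forall>v\<in>fibre A m. point_derivation A m (anchor A m v)) \<and>
     (\<forall>m. \<forall>f\<in>smooth_funs A. linear_on_set (fibre A m) (\<lambda>v. anchor A m v f)) \<and>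
     (\<forall>X\<in>sections A. \<forall>f\<in>smooth_funs A. anchor_deriv A X f \<in> smooth_funs A) \<and>
     (\<forall>X\<in>sections A. \<forall>Y\<in>sections A. bracket A X Y \<in> sections A) \<and>
     (\<forall>X\<in>sections A. \<forall>Y\<in>sections A. \<forall>Z\<in>sections A.
        bracket A (\<lambda>m. X m + Y m) Z = (\<lambda>m. bracket A X Z m + bracket A Y Z m)) \<and>
     (\<forall>X\<in>sections A. \<forall>Y\<in>sections A. \<forall>c.
        bracket A (\<lambda>m. c *\<^sub>R X m) Y = (\<lambda>m. c *\<^sub>R bracket A X Y m)) \<and>
     (\<forall>X\<in>sections A. \<forall>Y\<in>sections A. bracket A Y X = (\<lambda>m. - bracket A X Y m)) \<and>
     (\<forall>X\<in>sections A. \<forall>Y\<in>sections A. \<forall>Z\<in>sections A. \<forall>m.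
        bracket A X (bracket A Y Z) m + bracket A Y (bracket A Z X) m
          + bracket A Z (bracket A X Y) m = 0) \<and>
     (\<forall>X\<in>sections A. \<forall>Y\<in>sections A. \<forall>f\<in>smooth_funs A.
        bracket A X (\<lambda>m. f m *\<^sub>R Y m)
          = (\<lambda>m. f m *\<^sub>R bracket A X Y m + anchor_deriv A X f m *\<^sub>R Y m))"

text \<open>The differential of the Lie algebroid on functions and on \<open>2\<close>-forms.\<close>

definition d_fun ::
  "('m, 'e, 'v, 'f, 'z) lie_algebroid_scheme \<Rightarrow> ('m \<Rightarrow> real) \<Rightarrow> 'm \<Rightarrow> 'v \<Rightarrow> real" where
  "d_fun A f m v = (if v \<in> fibre A m then anchor A m v f else 0)"

definition d_two_form ::
  "('m, 'e, 'v, 'f, 'z) lie_algebroid_scheme \<Rightarrow> ('m \<Rightarrow> 'v \<Rightarrow> 'v \<Rightarrow> real)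
     \<Rightarrow> ('m \<Rightarrow> 'v) \<Rightarrow> ('m \<Rightarrow> 'v) \<Rightarrow> ('m \<Rightarrow> 'v) \<Rightarrow> 'm \<Rightarrow> real" where
  "d_two_form A \<omega> X Y Z m =
     anchor_deriv A X (\<lambda>x. \<omega> x (Y x) (Z x)) m
     - anchor_deriv A Y (\<lambda>x. \<omega> x (X x) (Z x)) m
     + anchor_deriv A Z (\<lambda>x. \<omega> x (X x) (Y x)) m
     - \<omega> m (bracket A X Y m) (Z m) + \<omega> m (bracket A X Z m) (Y m) - \<omega> m (bracket A Y Z m) (X m)"

definition symplectic ::
  "('m, 'e::real_normed_vector, 'v::real_vector, 'f::real_normed_vector, 'z) lie_algebroid_scheme
     \<Rightarrow> ('m \<Rightarrow> 'v \<Rightarrow> 'v \<Rightarrow> real) \<Rightarrow> bool" where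
  "symplectic A \<omega> \<longleftrightarrow>
     \<omega> \<in> two_forms A \<and>
     (\<forall>X\<in>sections A. \<forall>Y\<in>sections A. \<forall>Z\<in>sections A. \<forall>m. d_two_form A \<omega> X Y Z m = 0) \<and>
     (\<forall>m. \<forall>v\<in>fibre A m. (\<forall>w\<in>fibre A m. \<omega> m v w = 0) \<longrightarrow> v = 0)"

text \<open>The Lie derivative of a \<open>1\<close>-form: its pairing with a section is tensorial in that section, so that
  it determines a unique \<open>1\<close>-form.\<close>

definition lie_deriv ::
  "('m, 'e::real_normed_vector, 'v::real_vector, 'f::real_normed_vector, 'z) lie_algebroid_scheme
     \<Rightarrow> ('m \<Rightarrow> 'v) \<Rightarrow> ('m \<Rightarrow> 'v \<Rightarrow> real) \<Rightarrow> ('m \<Rightarrow> 'v \<Rightarrow> real)" where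
  "lie_deriv A X \<beta> = (THE \<gamma>. \<gamma> \<in> one_forms A \<and>
     (\<forall>Y\<in>sections A. \<forall>m.
        \<gamma> m (Y m) = anchor_deriv A X (\<lambda>x. \<beta> x (Y x)) m - \<beta> m (bracket A X Y m)))"

text \<open>
  The Schouten-Nijenhuis bracket of two bivector fields, as a field of alternating \<open>3\<close>-forms on the
  dual fibres: the biadditive extension of
  \<open>[X \<and> Y, Z \<and> W] = [X,Z] \<and> Y \<and> W - [X,W] \<and> Y \<and> Z - [Y,Z] \<and> X \<and> W + [Y,W] \<and> X \<and> Z\<close>,
  which does not depend on the decompositions.
\<close>

definition wedge3 :: "'v \<Rightarrow> 'v \<Rightarrow> 'v \<Rightarrow> ('v \<Rightarrow> real) \<Rightarrow> ('v \<Rightarrow> real) \<Rightarrow> ('v \<Rightarrow> real) \<Rightarrow> real" where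
  "wedge3 x y z \<xi> \<eta> \<zeta> =
     \<xi> x * (\<eta> y * \<zeta> z - \<eta> z * \<zeta> y)
     - \<xi> y * (\<eta> x * \<zeta> z - \<eta> z * \<zeta> x)
     + \<xi> z * (\<eta> x * \<zeta> y - \<eta> y * \<zeta> x)"

definition schouten ::
  "('m, 'e::real_normed_vector, 'v::real_vector, 'f::real_normed_vector, 'z) lie_algebroid_scheme
     \<Rightarrow> ('m \<Rightarrow> ('v \<Rightarrow> real) \<Rightarrow> ('v \<Rightarrow> real) \<Rightarrow> real)
     \<Rightarrow> ('m \<Rightarrow> ('v \<Rightarrow> real) \<Rightarrow> ('v \<Rightarrow> real) \<Rightarrow> real)
     \<Rightarrow> ('m \<Rightarrow> ('v \<Rightarrow> real) \<Rightarrow> ('v \<Rightarrow> real) \<Rightarrow> ('v \<Rightarrow> real) \<Rightarrow> real)" where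
  "schouten A P Q = (THE T.
     \<forall>ps qs. decomposes A P ps \<longrightarrow> decomposes A Q qs \<longrightarrow>
       (\<forall>m \<xi> \<eta> \<zeta>. T m \<xi> \<eta> \<zeta> =
          (if \<xi> \<in> fibre_dual A m \<and> \<eta> \<in> fibre_dual A m \<and> \<zeta> \<in> fibre_dual A m then
             (\<Sum>(X, Y)\<leftarrow>ps. \<Sum>(Z, W)\<leftarrow>qs.
                wedge3 (bracket A X Z m) (Y m) (W m) \<xi> \<eta> \<zeta>
                - wedge3 (bracket A X W m) (Y m) (Z m) \<xi> \<eta> \<zeta>
                - wedge3 (bracket A Y Z m) (X m) (W m) \<xi> \<eta> \<zeta>
                + wedge3 (bracket A Y W m) (X m) (Z m) \<xi> \<eta> \<zeta>)
           else 0)))"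


section \<open>Poisson-Nijenhuis structures\<close>

definition deformed_bracket ::
  "('m, 'e, 'v::real_vector, 'f, 'z) lie_algebroid_scheme \<Rightarrow> ('m \<Rightarrow> 'v \<Rightarrow> 'v)
     \<Rightarrow> ('m \<Rightarrow> 'v) \<Rightarrow> ('m \<Rightarrow> 'v) \<Rightarrow> ('m \<Rightarrow> 'v)" where
  "deformed_bracket A N X Y = (\<lambda>m.
     bracket A (\<lambda>x. N x (X x)) Y m + bracket A X (\<lambda>x. N x (Y x)) m - N m (bracket A X Y m))"

definition torsion ::
  "('m, 'e, 'v::real_vector, 'f, 'z) lie_algebroid_scheme \<Rightarrow> ('m \<Rightarrow> 'v \<Rightarrow> 'v)
     \<Rightarrow> ('m \<Rightarrow> 'v) \<Rightarrow> ('m \<Rightarrow> 'v) \<Rightarrow> ('m \<Rightarrow> 'v)" where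
  "torsion A N X Y = (\<lambda>m.
     bracket A (\<lambda>x. N x (X x)) (\<lambda>x. N x (Y x)) m - N m (deformed_bracket A N X Y m))"

text \<open>The deformed structure \<open>(\<rho> \<circ> N, [\<cdot>,\<cdot>]\<^sub>N)\<close> on the same vector bundle.\<close>

definition deform ::
  "('m, 'e, 'v::real_vector, 'f) lie_algebroid \<Rightarrow> ('m \<Rightarrow> 'v \<Rightarrow> 'v) \<Rightarrow> ('m, 'e, 'v, 'f) lie_algebroid"
where
  "deform A N = A\<lparr>bracket := deformed_bracket A N, anchor := (\<lambda>m v. anchor A m (N m v))\<rparr>"

definition form_bracket ::
  "('m, 'e::real_normed_vector, 'v::real_vector, 'f::real_normed_vector, 'z) lie_algebroid_scheme
     \<Rightarrow> ('m \<Rightarrow> ('v \<Rightarrow> real) \<Rightarrow> ('v \<Rightarrow> real) \<Rightarrow> real)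
     \<Rightarrow> ('m \<Rightarrow> 'v \<Rightarrow> real) \<Rightarrow> ('m \<Rightarrow> 'v \<Rightarrow> real) \<Rightarrow> ('m \<Rightarrow> 'v \<Rightarrow> real)" where
  "form_bracket A P \<alpha> \<beta> = (\<lambda>m v.
     lie_deriv A (\<lambda>x. sharp A P x (\<alpha> x)) \<beta> m v
     - lie_deriv A (\<lambda>x. sharp A P x (\<beta> x)) \<alpha> m v
     - d_fun A (\<lambda>x. P x (\<alpha> x) (\<beta> x)) m v)"

definition magri_morosi ::
  "('m, 'e::real_normed_vector, 'v::real_vector, 'f::real_normed_vector) lie_algebroid
     \<Rightarrow> ('m \<Rightarrow> ('v \<Rightarrow> real) \<Rightarrow> ('v \<Rightarrow> real) \<Rightarrow> real) \<Rightarrow> ('m \<Rightarrow> 'v \<Rightarrow> 'v)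
     \<Rightarrow> ('m \<Rightarrow> 'v \<Rightarrow> real) \<Rightarrow> ('m \<Rightarrow> 'v \<Rightarrow> real) \<Rightarrow> ('m \<Rightarrow> 'v \<Rightarrow> real)" where
  "magri_morosi A P N \<alpha> \<beta> = (\<lambda>m v.
     form_bracket (deform A N) P \<alpha> \<beta> m v
     - (form_bracket A P (\<lambda>x. transpose_endo A N x (\<alpha> x)) \<beta> m v
        + form_bracket A P \<alpha> (\<lambda>x. transpose_endo A N x (\<beta> x)) m v
        - transpose_endo A N m (form_bracket A P \<alpha> \<beta> m) v))"

definition PN_structure ::
  "('m, 'e::real_normed_vector, 'v::real_vector, 'f::real_normed_vector) lie_algebroid
     \<Rightarrow> ('m \<Rightarrow> ('v \<Rightarrow> real) \<Rightarrow> ('v \<Rightarrow> real) \<Rightarrow> real) \<Rightarrow> ('m \<Rightarrow> 'v \<Rightarrow> 'v) \<Rightarrow> bool" where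
  "PN_structure A P N \<longleftrightarrow>
     P \<in> bivector_fields A \<and> N \<in> endomorphisms A \<and>
     schouten A P P = (\<lambda>m \<xi> \<eta> \<zeta>. 0) \<and>
     (\<forall>X\<in>sections A. \<forall>Y\<in>sections A. torsion A N X Y = (\<lambda>m. 0)) \<and>
     (\<forall>m. \<forall>\<xi>\<in>fibre_dual A m. N m (sharp A P m \<xi>) = sharp A P m (transpose_endo A N m \<xi>)) \<and>
     (\<forall>\<alpha>\<in>one_forms A. \<forall>\<beta>\<in>one_forms A. magri_morosi A P N \<alpha> \<beta> = (\<lambda>m v. 0))"


section \<open>Hypersymplectic structures\<close>

definition inverse_bivector ::
  "('m, 'e::real_normed_vector, 'v::real_vector, 'f::real_normed_vector, 'z) vector_bundle_scheme
     \<Rightarrow> ('m \<Rightarrow> 'v \<Rightarrow> 'v \<Rightarrow> real) \<Rightarrow> ('m \<Rightarrow> ('v \<Rightarrow> real) \<Rightarrow> ('v \<Rightarrow> real) \<Rightarrow> real) \<Rightarrow> bool" where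
  "inverse_bivector A \<omega> P \<longleftrightarrow>
     P \<in> bivector_fields A \<and>
     (\<forall>m. \<forall>\<xi>\<in>fibre_dual A m. flat A \<omega> m (sharp A P m \<xi>) = \<xi>) \<and>
     (\<forall>m. \<forall>v\<in>fibre A m. sharp A P m (flat A \<omega> m v) = v)"

text \<open>The index type \<open>3\<close> is the ring of integers modulo \<open>3\<close>, with \<open>UNIV = {1, 2, 3}\<close> and \<open>3 = 0\<close>.\<close>

definition transition ::
  "('m, 'e, 'v::real_vector, 'f, 'z) vector_bundle_scheme \<Rightarrow> (3 \<Rightarrow> 'm \<Rightarrow> 'v \<Rightarrow> 'v \<Rightarrow> real)
     \<Rightarrow> (3 \<Rightarrow> 'm \<Rightarrow> ('v \<Rightarrow> real) \<Rightarrow> ('v \<Rightarrow> real) \<Rightarrow> real) \<Rightarrow> 3 \<Rightarrow> 'm \<Rightarrow> 'v \<Rightarrow> 'v" where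
  "transition A \<omega> \<pi> i = (\<lambda>m v. sharp A (\<pi> (i - 1)) m (flat A (\<omega> (i + 1)) m v))"

definition hypersymplectic ::
  "('m, 'e::real_normed_vector, 'v::real_vector, 'f::real_normed_vector, 'z) lie_algebroid_scheme
     \<Rightarrow> (3 \<Rightarrow> 'm \<Rightarrow> 'v \<Rightarrow> 'v \<Rightarrow> real)
     \<Rightarrow> (3 \<Rightarrow> 'm \<Rightarrow> ('v \<Rightarrow> real) \<Rightarrow> ('v \<Rightarrow> real) \<Rightarrow> real) \<Rightarrow> (3 \<Rightarrow> real) \<Rightarrow> bool" where
  "hypersymplectic A \<omega> \<pi> \<epsilon> \<longleftrightarrow>
     (\<forall>i. symplectic A (\<omega> i) \<and> inverse_bivector A (\<omega> i) (\<pi> i) \<and> \<epsilon> i \<in> {1, -1} \<and>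
        (\<forall>m. \<forall>v\<in>fibre A m.
           transition A \<omega> \<pi> i m (transition A \<omega> \<pi> i m v) = \<epsilon> i *\<^sub>R v))"

definition g_flat ::
  "('m, 'e, 'v::real_vector, 'f, 'z) vector_bundle_scheme \<Rightarrow> (3 \<Rightarrow> 'm \<Rightarrow> 'v \<Rightarrow> 'v \<Rightarrow> real)
     \<Rightarrow> (3 \<Rightarrow> 'm \<Rightarrow> ('v \<Rightarrow> real) \<Rightarrow> ('v \<Rightarrow> real) \<Rightarrow> real) \<Rightarrow> (3 \<Rightarrow> real)
     \<Rightarrow> 'm \<Rightarrow> 'v \<Rightarrow> ('v \<Rightarrow> real)" where
  "g_flat A \<omega> \<pi> \<epsilon> m v =
     (\<lambda>w. \<epsilon> 3 * \<epsilon> 2 * flat A (\<omega> 3) m (sharp A (\<pi> 1) m (flat A (\<omega> 2) m v)) w)"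

definition g_inv ::
  "('m, 'e, 'v::real_vector, 'f, 'z) vector_bundle_scheme \<Rightarrow> (3 \<Rightarrow> 'm \<Rightarrow> 'v \<Rightarrow> 'v \<Rightarrow> real)
     \<Rightarrow> (3 \<Rightarrow> 'm \<Rightarrow> ('v \<Rightarrow> real) \<Rightarrow> ('v \<Rightarrow> real) \<Rightarrow> real) \<Rightarrow> (3 \<Rightarrow> real)
     \<Rightarrow> 'm \<Rightarrow> ('v \<Rightarrow> real) \<Rightarrow> ('v \<Rightarrow> real) \<Rightarrow> real" where
  "g_inv A \<omega> \<pi> \<epsilon> m \<xi> \<eta> = \<eta> (inv_into (fibre A m) (g_flat A \<omega> \<pi> \<epsilon> m) \<xi>)"

end

theory Submission
  imports Defs
begin

text \<open>
  If \<open>\<omega>\<close> is symplectic with inverse \<open>P\<close>, \<open>N\<^sup>2 = e Id\<close> and \<open>\<omega>N = \<omega>(N _, _)\<close> is again a closed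
  2-form, then \<open>(P, N)\<close> is a PN structure.  Indeed
  \<open>\<omega>(torsion(X,Y), Z) = d\<omega>N(NX,Y,Z) + d\<omega>N(X,NY,Z) - d\<omega>(NX,NY,Z) - e d\<omega>(X,Y,Z)\<close>.  The isomorphism
  \<open>\<omega>\<^sup>\<flat>\<close> turns the concomitant into the differential of \<open>\<omega>\<close> for the deformed bracket, which is
  \<open>d\<omega>(NX,Y,Z) + d\<omega>(X,NY,Z) + d\<omega>(X,Y,NZ) - 2 d\<omega>N(X,Y,Z)\<close>, and it turns \<open>[P, P]\<close> into \<open>2 d\<omega>\<close>.

  In a hypersymplectic structure \<open>\<omega>\<^sub>i\<^sub>-\<^sub>1(N\<^sub>i _, _) = \<omega>\<^sub>i\<^sub>+\<^sub>1\<close>, so the \<open>N\<^sub>i\<close> are torsion-free.  As the product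
  of the signs is 1, they commute and \<open>\<omega>\<^sub>i(N\<^sub>i _, _)\<close> is, up to sign, the same 2-form \<open>g\<close> for all \<open>i\<close>.
  The torsion identity for \<open>(\<omega>\<^sub>i, N\<^sub>i)\<close> now reads \<open>dg(N\<^sub>i X,Y,Z) = - dg(X,N\<^sub>i Y,Z)\<close>.  Applied three times,
  with \<open>N\<^sub>3 N\<^sub>2 N\<^sub>1 = N\<^sub>1 N\<^sub>2 N\<^sub>3 = Id\<close>, it gives \<open>dg = - dg\<close>.  Hence the criterion applies to
  \<open>(\<pi>\<^sub>i, N\<^sub>i)\<close> and to \<open>(g\<inverse>, N\<^sub>i)\<close>.
\<close>

subsection \<open>Smooth functions and sections\<close>

text \<open>\<open>frechet_derivative\<close> is a choice among the derivatives of \<open>f\<close>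
  at \<open>x\<close>, so it depends only on the predicate \<open>has_derivative\<close> at
  \<open>x\<close>, which is local.\<close>

lemma frechet_derivative_cong_open:
  assumes "open U" "x \<in> U" "\<And>y. y \<in> U \<Longrightarrow> f y = g y"
  shows "frechet_derivative f (at x) = frechet_derivative g (at x)"
proof -
  have "(f has_derivative D) (at x) \<longleftrightarrow> (g has_derivative D) (at x)" for D
    using has_derivative_transform_within_open[OF _ assms(1,2), of f D UNIV g]
      has_derivative_transform_within_open[OF _ assms(1,2), of g D UNIV f] assms(3) by auto
  then show ?thesis unfolding frechet_derivative_def by simp
qed

text \<open>Trivializations are linear only over their domains, and \<open>inv_into U \<phi>\<close>
  inverts a chart only on its image. Identities are thus available on open sets only, and smoothness
  has to be transported along them there.\<close>

lemma Ck_on_cong: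
  assumes "open U" "\<And>y. y \<in> U \<Longrightarrow> f y = g y"
  shows "Ck_on k U f \<longleftrightarrow> Ck_on k U g"
  using assms(2)
proof (induction k arbitrary: f g)
  case 0
  then show ?case by (auto cong: continuous_on_cong)
next
  case (Suc k)
  have "(f has_derivative D) (at x within U) \<longleftrightarrow> (g has_derivative D) (at x within U)"
    if "x \<in> U" for x D
    using has_derivative_transform[OF that, of g f] has_derivative_transform[OF that, of f g] Suc.prems
    by auto
  then have "f differentiable_on U \<longleftrightarrow> g differentiable_on U"
    by (auto simp: differentiable_on_def differentiable_def)
  moreover have "Ck_on k U (\<lambda>x. frechet_derivative f (at x) v)
      \<longleftrightarrow> Ck_on k U (\<lambda>x. frechet_derivative g (at x) v)" for v
    by (intro Suc.IH) (simp add: frechet_derivative_cong_open[OF assms(1) _ Suc.prems])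
  ultimately show ?case by simp
qed

lemma Ck_on_subset: "Ck_on k V f \<Longrightarrow> U \<subseteq> V \<Longrightarrow> Ck_on k U f"
  by (induction k arbitrary: f) (auto intro: continuous_on_subset differentiable_on_subset)

text \<open>Serves the product rule, whose terms contain undifferentiated factors of one order more
  than required.\<close>

lemma Ck_on_Suc_imp: "Ck_on (Suc k) U f \<Longrightarrow> Ck_on k U f"
proof (induction k arbitrary: f)
  case 0
  then show ?case by (simp add: differentiable_imp_continuous_on)
next
  case (Suc k)
  then show ?case by (metis Ck_on.simps(2))
qed

lemma Ck_on_const: "Ck_on k U (\<lambda>x. c)"
  by (induction k arbitrary: c) auto

lemma differentiable_on_open_at:
  "open U \<Longrightarrow> f differentiable_on U \<Longrightarrow> x \<in> U \<Longrightarrow> (f has_derivative frechet_derivative f (at x)) (at x)"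
  by (metis differentiable_on_def at_within_open frechet_derivative_works)

lemma Ck_on_add:
  assumes "open U"
  shows "Ck_on k U f \<Longrightarrow> Ck_on k U g \<Longrightarrow> Ck_on k U (\<lambda>x. f x + g x)"
proof (induction k arbitrary: f g)
  case 0
  then show ?case by (auto intro: continuous_on_add)
next
  case (Suc k)
  have "frechet_derivative (\<lambda>x. f x + g x) (at x)
      = (\<lambda>v. frechet_derivative f (at x) v + frechet_derivative g (at x) v)" if "x \<in> U" for x
    using Suc.prems that assms
    by (intro frechet_derivative_at[symmetric] has_derivative_add differentiable_on_open_at[of U]) auto
  then have "Ck_on k U (\<lambda>x. frechet_derivative (\<lambda>x. f x + g x) (at x) v)" for v
    using Suc by (subst Ck_on_cong[OF assms, where g = "\<lambda>x. frechet_derivative f (at x) v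
        + frechet_derivative g (at x) v"]) auto
  with Suc.prems show ?case by auto
qed

lemma Ck_on_scaleR:
  fixes f :: "'e::real_normed_vector \<Rightarrow> real" and g :: "'e \<Rightarrow> 'f::real_normed_vector"
  assumes "open U"
  shows "Ck_on k U f \<Longrightarrow> Ck_on k U g \<Longrightarrow> Ck_on k U (\<lambda>x. f x *\<^sub>R g x)"
proof (induction k arbitrary: f g)
  case 0
  then show ?case by (auto intro: continuous_on_scaleR)
next
  case (Suc k)
  have "((\<lambda>x. f x *\<^sub>R g x) has_derivative
      (\<lambda>v. f x *\<^sub>R frechet_derivative g (at x) v + frechet_derivative f (at x) v *\<^sub>R g x)) (at x)"
    if "x \<in> U" for x
    using Suc.prems that assms
    by (intro has_derivative_scaleR differentiable_on_open_at[of U]) auto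
  note D = this
  then have "frechet_derivative (\<lambda>x. f x *\<^sub>R g x) (at x)
      = (\<lambda>v. f x *\<^sub>R frechet_derivative g (at x) v + frechet_derivative f (at x) v *\<^sub>R g x)"
    if "x \<in> U" for x
    using that by (intro frechet_derivative_at[symmetric]) auto
  moreover have "Ck_on k U (\<lambda>x. f x *\<^sub>R frechet_derivative g (at x) v + frechet_derivative f (at x) v *\<^sub>R g x)" for v
    using Suc.prems Ck_on_Suc_imp[OF Suc.prems(1)] Ck_on_Suc_imp[OF Suc.prems(2)]
    by (intro Ck_on_add[OF assms] Suc.IH) auto
  ultimately have "Ck_on k U (\<lambda>x. frechet_derivative (\<lambda>x. f x *\<^sub>R g x) (at x) v)" for v
    by (subst Ck_on_cong[OF assms, where g = "\<lambda>x. f x *\<^sub>R frechet_derivative g (at x) v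
        + frechet_derivative f (at x) v *\<^sub>R g x"]) auto
  moreover have "(\<lambda>x. f x *\<^sub>R g x) differentiable_on U"
    using D by (auto simp: differentiable_on_def differentiable_def intro: has_derivative_at_withinI)
  ultimately show ?case by simp
qed

section \<open>Smoothness of functions read in charts\<close>

context
  fixes \<A> :: "('m::{t2_space,second_countable_topology} set \<times> ('m \<Rightarrow> 'e::real_normed_vector)) set"
  assumes mfd: "smooth_manifold \<A>"
begin

lemma chart_image_open:
  assumes "(U, \<phi>) \<in> \<A>" "open W"
  shows "open (\<phi> ` (U \<inter> W))"
proof -
  have "open (\<phi> ` U)" and h: "homeomorphism U (\<phi> ` U) \<phi> (inv_into U \<phi>)"
    using mfd assms by (auto simp: smooth_manifold_def)
  moreover have "openin (top_of_set (\<phi> ` U)) (\<phi> ` (U \<inter> W))"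
    by (rule homeomorphism_imp_open_map[OF h]) (use assms in \<open>auto intro: openin_open_Int\<close>)
  ultimately show ?thesis using openin_open_trans by blast
qed

lemma chart_inv_into:
  assumes "(U, \<phi>) \<in> \<A>" "y \<in> \<phi> ` (U \<inter> W)"
  shows "inv_into U \<phi> y \<in> U \<inter> W"
proof -
  have "homeomorphism U (\<phi> ` U) \<phi> (inv_into U \<phi>)"
    using mfd assms by (auto simp: smooth_manifold_def)
  with assms(2) show ?thesis by (auto simp: homeomorphism_def)
qed

lemma mfd_smooth_on_cong:
  assumes "open W" "\<And>m. m \<in> W \<Longrightarrow> f m = g m" "mfd_smooth_on \<A> W f"
  shows "mfd_smooth_on \<A> W g"
  unfolding mfd_smooth_on_def smooth_on_def
proof clarify
  fix U \<phi> k assume c: "(U, \<phi>) \<in> \<A>"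
  have "Ck_on k (\<phi> ` (U \<inter> W)) (f \<circ> inv_into U \<phi>)"
    using assms(3) c by (auto simp: mfd_smooth_on_def smooth_on_def)
  moreover have "(f \<circ> inv_into U \<phi>) y = (g \<circ> inv_into U \<phi>) y" if "y \<in> \<phi> ` (U \<inter> W)" for y
    using chart_inv_into[OF c that] assms(2) by simp
  ultimately show "Ck_on k (\<phi> ` (U \<inter> W)) (g \<circ> inv_into U \<phi>)"
    using Ck_on_cong[OF chart_image_open[OF c assms(1)], of "f \<circ> inv_into U \<phi>" "g \<circ> inv_into U \<phi>"]
    by blast
qed

lemma mfd_smooth_on_add:
  assumes "open W" "mfd_smooth_on \<A> W f" "mfd_smooth_on \<A> W g"
  shows "mfd_smooth_on \<A> W (\<lambda>m. f m + g m)"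
  using assms Ck_on_add[OF chart_image_open] by (fastforce simp: mfd_smooth_on_def smooth_on_def o_def)

lemma mfd_smooth_on_scaleR:
  assumes "open W" "mfd_smooth_on \<A> W f" "mfd_smooth_on \<A> W g"
  shows "mfd_smooth_on \<A> W (\<lambda>m. f m *\<^sub>R g m)"
  using assms Ck_on_scaleR[OF chart_image_open] by (fastforce simp: mfd_smooth_on_def smooth_on_def o_def)

end

lemma mfd_smooth_on_const: "mfd_smooth_on \<A> W (\<lambda>m. c)"
  by (auto simp: mfd_smooth_on_def smooth_on_def o_def Ck_on_const)

lemma mfd_smooth_on_subset: "mfd_smooth_on \<A> V f \<Longrightarrow> W \<subseteq> V \<Longrightarrow> mfd_smooth_on \<A> W f"
  by (fastforce simp: mfd_smooth_on_def smooth_on_def intro: Ck_on_subset)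

section \<open>Sections as a module over the ring of smooth functions\<close>

context
  fixes A :: "('m::{t2_space,second_countable_topology}, 'e::real_normed_vector, 'v::real_vector,
               'f::real_normed_vector, 'z) vector_bundle_scheme"
  assumes vb: "vector_bundle A"
begin

lemma smooth_funs_const: "(\<lambda>m. c) \<in> smooth_funs A"
  by (simp add: smooth_funs_def mfd_smooth_on_const)

lemma smooth_funs_add: "f \<in> smooth_funs A \<Longrightarrow> g \<in> smooth_funs A \<Longrightarrow> (\<lambda>m. f m + g m) \<in> smooth_funs A"
  using vb by (auto simp: smooth_funs_def vector_bundle_def intro: mfd_smooth_on_add)

lemma smooth_funs_mult: "f \<in> smooth_funs A \<Longrightarrow> g \<in> smooth_funs A \<Longrightarrow> (\<lambda>m. f m * g m) \<in> smooth_funs A"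
  using vb mfd_smooth_on_scaleR[of "charts A" UNIV f g] by (auto simp: smooth_funs_def vector_bundle_def)

lemma sections_add:
  assumes "X \<in> sections A" "Y \<in> sections A"
  shows "(\<lambda>m. X m + Y m) \<in> sections A"
  unfolding sections_def
proof (intro CollectI conjI allI ballI, goal_cases)
  case (1 m)
  then show ?case using assms vb by (auto simp: sections_def vector_bundle_def intro: subspace_add)
next
  case (2 x)
  obtain U \<tau> where x: "x = (U, \<tau>)" by force
  have "mfd_smooth_on (charts A) U (\<lambda>m. \<tau> m (X m) + \<tau> m (Y m))"
    using assms 2 vb by (auto simp: x sections_def vector_bundle_def intro!: mfd_smooth_on_add)
  then have "mfd_smooth_on (charts A) U (\<lambda>m. \<tau> m (X m + Y m))"
    by (rule mfd_smooth_on_cong[rotated -1])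
       (use assms 2 vb in \<open>auto simp: x sections_def vector_bundle_def linear_on_set_def\<close>)
  then show ?case by (simp add: x)
qed

lemma sections_scaleR:
  assumes "f \<in> smooth_funs A" "X \<in> sections A"
  shows "(\<lambda>m. f m *\<^sub>R X m) \<in> sections A"
  unfolding sections_def
proof (intro CollectI conjI allI ballI, goal_cases)
  case (1 m)
  then show ?case using assms vb by (auto simp: sections_def vector_bundle_def intro: subspace_scale)
next
  case (2 x)
  obtain U \<tau> where x: "x = (U, \<tau>)" by force
  have "mfd_smooth_on (charts A) U (\<lambda>m. f m *\<^sub>R \<tau> m (X m))"
    using assms 2 vb by (auto simp: x sections_def smooth_funs_def vector_bundle_def
        intro!: mfd_smooth_on_scaleR intro: mfd_smooth_on_subset)
  then have "mfd_smooth_on (charts A) U (\<lambda>m. \<tau> m (f m *\<^sub>R X m))"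
    by (rule mfd_smooth_on_cong[rotated -1])
       (use assms 2 vb in \<open>auto simp: x sections_def vector_bundle_def linear_on_set_def\<close>)
  then show ?case by (simp add: x)
qed

lemma sections_zero: "(\<lambda>m. 0) \<in> sections A"
  unfolding sections_def
proof (intro CollectI conjI allI ballI, goal_cases)
  case (1 m)
  then show ?case using vb by (auto simp: vector_bundle_def intro: subspace_0)
next
  case (2 x)
  obtain U \<tau> where x: "x = (U, \<tau>)" by force
  have "\<tau> m 0 = 0" if "m \<in> U" for m
  proof -
    have "0 \<in> fibre A m" and l: "linear_on_set (fibre A m) (\<tau> m)"
      using vb 2 that by (auto simp: x vector_bundle_def intro: subspace_0)
    \<comment> \<open>\<open>linear_on_set\<close> does not mention \<open>0\<close>; homogeneity
      with the scalar \<open>0\<close> supplies its image.\<close>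
    then have "\<tau> m (0 *\<^sub>R 0) = 0 *\<^sub>R \<tau> m 0" unfolding linear_on_set_def by blast
    then show ?thesis by simp
  qed
  then have "mfd_smooth_on (charts A) U (\<lambda>m. \<tau> m 0)"
    by (intro mfd_smooth_on_cong[rotated -1, OF mfd_smooth_on_const[where c = 0]])
       (use 2 vb in \<open>auto simp: x vector_bundle_def\<close>)
  then show ?case by (simp add: x)
qed

end

subsection \<open>Two-forms and bivector fields\<close>

text \<open>Linearity is known on \<open>S\<close> only, so the induction has to keep every partial
  sum inside the subspace \<open>S\<close>.\<close>

lemma linear_on_set_sum:
  assumes "subspace S" "linear_on_set S f" "finite I" "\<And>k. k \<in> I \<Longrightarrow> v k \<in> S"
  shows "f (\<Sum>k\<in>I. c k *\<^sub>R v k) = (\<Sum>k\<in>I. c k *\<^sub>R f (v k))"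
  using assms(3,4)
proof (induction I rule: finite_induct)
  case empty
  have "f (0 *\<^sub>R 0) = 0 *\<^sub>R f 0"
    using assms(1,2) unfolding linear_on_set_def by (metis subspace_0)
  then show ?case by simp
next
  case (insert k I)
  then have "c k *\<^sub>R v k \<in> S" "(\<Sum>k\<in>I. c k *\<^sub>R v k) \<in> S"
    using assms(1) by (auto intro: subspace_scale subspace_sum)
  then show ?case using insert assms(2) by (simp add: linear_on_set_def)
qed

lemma linear_on_set_minus: "linear_on_set S f \<Longrightarrow> v \<in> S \<Longrightarrow> f (- v) = - f v"
  unfolding linear_on_set_def by (metis scaleR_minus1_left)

lemma fibre_dual_linear: "\<xi> \<in> fibre_dual A m \<Longrightarrow> linear_on_set (fibre A m) \<xi>"
  by (simp add: fibre_dual_def)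

lemma section_in_fibre: "X \<in> sections A \<Longrightarrow> X m \<in> fibre A m"
  by (simp add: sections_def)

lemma endomorphism_section: "N \<in> endomorphisms A \<Longrightarrow> X \<in> sections A \<Longrightarrow> (\<lambda>m. N m (X m)) \<in> sections A"
  by (simp add: endomorphisms_def)

lemma endomorphism_in_fibre: "N \<in> endomorphisms A \<Longrightarrow> v \<in> fibre A m \<Longrightarrow> N m v \<in> fibre A m"
  by (auto simp: endomorphisms_def)

lemma endomorphism_linear: "N \<in> endomorphisms A \<Longrightarrow> linear_on_set (fibre A m) (N m)"
  by (simp add: endomorphisms_def)

lemma one_form_dual: "\<alpha> \<in> one_forms A \<Longrightarrow> \<alpha> m \<in> fibre_dual A m"
  by (simp add: one_forms_def)

lemma one_form_smooth: "\<alpha> \<in> one_forms A \<Longrightarrow> X \<in> sections A \<Longrightarrow> (\<lambda>m. \<alpha> m (X m)) \<in> smooth_funs A"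
  by (simp add: one_forms_def)

text \<open>Encodes \<open>X \<and> Y = X \<otimes> Y + Y \<otimes> (- X)\<close>: a sum of wedge
  products becomes a sum of simple tensors, with the sign absorbed into a section.\<close>

definition alternating_pairs :: "(('m \<Rightarrow> 'v::real_vector) \<times> ('m \<Rightarrow> 'v)) list \<Rightarrow> (('m \<Rightarrow> 'v) \<times> ('m \<Rightarrow> 'v)) list"
  where "alternating_pairs ps = concat (map (\<lambda>(X, Y). [(X, Y), (Y, \<lambda>m. - X m)]) ps)"

lemma sum_list_alternating_pairs:
  fixes F :: "('m \<Rightarrow> 'v::real_vector) \<Rightarrow> ('m \<Rightarrow> 'v) \<Rightarrow> 'a::comm_monoid_add"
  shows "(\<Sum>(X, Y)\<leftarrow>ps. F X Y + F Y (\<lambda>m. - X m)) = (\<Sum>(X, Y)\<leftarrow>alternating_pairs ps. F X Y)"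
  by (induction ps) (auto simp: alternating_pairs_def add.assoc)

lemma sum_list_pairs_nth:
  "(\<Sum>(X, Y)\<leftarrow>us. F X Y) = (\<Sum>k<length us. F (fst (us ! k)) (snd (us ! k)))"
  by (simp add: sum_list_sum_nth case_prod_beta atLeast0LessThan)

section \<open>Bivector fields as sums of simple tensors\<close>

context
  fixes A :: "('m::{t2_space,second_countable_topology}, 'e::real_normed_vector, 'v::real_vector,
               'f::real_normed_vector, 'z) vector_bundle_scheme"
  assumes vb: "vector_bundle A"
begin

lemma subspace_fibre: "subspace (fibre A m)"
  using vb by (simp add: vector_bundle_def)

lemma sections_minus: "X \<in> sections A \<Longrightarrow> (\<lambda>m. - X m) \<in> sections A"
  using sections_scaleR[OF vb smooth_funs_const[OF vb, of "-1"]] by auto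

lemma sections_sum:
  "finite I \<Longrightarrow> (\<And>k. k \<in> I \<Longrightarrow> X k \<in> sections A) \<Longrightarrow> (\<lambda>m. \<Sum>k\<in>I. X k m) \<in> sections A"
  by (induction I rule: finite_induct) (auto intro: sections_zero[OF vb] sections_add[OF vb])

lemma smooth_funs_sum:
  "finite I \<Longrightarrow> (\<And>k. k \<in> I \<Longrightarrow> f k \<in> smooth_funs A) \<Longrightarrow> (\<lambda>m. \<Sum>k\<in>I. f k m) \<in> smooth_funs A"
  by (induction I rule: finite_induct) (auto intro: smooth_funs_const[OF vb] smooth_funs_add[OF vb])

lemma smooth_funs_minus: "f \<in> smooth_funs A \<Longrightarrow> (\<lambda>m. - f m) \<in> smooth_funs A"
  using smooth_funs_mult[OF vb smooth_funs_const[OF vb, of "-1"]] by auto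

lemma alternating_pairs_sections:
  "decomposes A P ps \<Longrightarrow> set (alternating_pairs ps) \<subseteq> sections A \<times> sections A"
  by (auto simp: decomposes_def alternating_pairs_def intro: sections_minus)

lemma decomposes_alternating_pairs:
  assumes "decomposes A P ps" "\<xi> \<in> fibre_dual A m" "\<eta> \<in> fibre_dual A m"
  shows "P m \<xi> \<eta> = (\<Sum>k<length (alternating_pairs ps). \<xi> (fst (alternating_pairs ps ! k) m)
            * \<eta> (snd (alternating_pairs ps ! k) m))"
proof -
  have "P m \<xi> \<eta> = (\<Sum>(X, Y)\<leftarrow>ps. \<xi> (X m) * \<eta> (Y m) - \<xi> (Y m) * \<eta> (X m))"
    using assms by (auto simp: decomposes_def)
  also have "\<dots> = (\<Sum>(X, Y)\<leftarrow>ps. \<xi> (X m) * \<eta> (Y m) + \<xi> (Y m) * \<eta> (- X m))"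
    using assms(1)
    by (intro arg_cong[where f = sum_list] map_cong)
       (auto simp: decomposes_def linear_on_set_minus[OF fibre_dual_linear[OF assms(3)]] section_in_fibre)
  also have "\<dots> = (\<Sum>(X, Y)\<leftarrow>alternating_pairs ps. \<xi> (X m) * \<eta> (Y m))"
    using sum_list_alternating_pairs[of "\<lambda>X Y. \<xi> (X m) * \<eta> (Y m)" ps] by simp
  finally show ?thesis unfolding sum_list_pairs_nth .
qed

lemma bivector_expansion:
  assumes "P \<in> bivector_fields A"
  obtains n :: nat and U V where "\<And>k. k < n \<Longrightarrow> U k \<in> sections A" "\<And>k. k < n \<Longrightarrow> V k \<in> sections A"
    "\<And>m \<xi> \<eta>. \<xi> \<in> fibre_dual A m \<Longrightarrow> \<eta> \<in> fibre_dual A m \<Longrightarrow> P m \<xi> \<eta> = (\<Sum>k<n. \<xi> (U k m) * \<eta> (V k m))"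
proof -
  obtain ps where ps: "decomposes A P ps"
    using assms by (auto simp: bivector_fields_def)
  show ?thesis
    by (rule that[of "length (alternating_pairs ps)" "\<lambda>k. fst (alternating_pairs ps ! k)"
          "\<lambda>k. snd (alternating_pairs ps ! k)"])
       (use alternating_pairs_sections[OF ps] decomposes_alternating_pairs[OF ps] nth_mem
        in \<open>fastforce+\<close>)
qed

lemma bivector_fieldsI:
  fixes n :: nat
  assumes U: "\<And>k. k < n \<Longrightarrow> U k \<in> sections A" and V: "\<And>k. k < n \<Longrightarrow> V k \<in> sections A"
    and P: "\<And>m \<xi> \<eta>. \<xi> \<in> fibre_dual A m \<Longrightarrow> \<eta> \<in> fibre_dual A m \<Longrightarrow> P m \<xi> \<eta> = (\<Sum>k<n. \<xi> (U k m) * \<eta> (V k m))"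
    and skew: "\<And>m \<xi> \<eta>. \<xi> \<in> fibre_dual A m \<Longrightarrow> \<eta> \<in> fibre_dual A m \<Longrightarrow> P m \<eta> \<xi> = - P m \<xi> \<eta>"
  shows "P \<in> bivector_fields A"
proof -
  \<comment> \<open>A skew \<open>P\<close> is its own skew part, so the sum of the
    \<open>U k \<otimes> V k\<close> is half the sum of the \<open>U k \<and> V k\<close>; the half
    goes into the first factor.\<close>
  let ?ps = "map (\<lambda>k. (\<lambda>m. (1/2) *\<^sub>R U k m, V k)) [0..<n]"
  have "P m \<xi> \<eta> = (\<Sum>(X, Y)\<leftarrow>?ps. \<xi> (X m) * \<eta> (Y m) - \<xi> (Y m) * \<eta> (X m))"
    if "\<xi> \<in> fibre_dual A m" "\<eta> \<in> fibre_dual A m" for m \<xi> \<eta>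
  proof -
    have s: "\<zeta> ((1/2) *\<^sub>R U k m) = \<zeta> (U k m) / 2" if "k < n" "\<zeta> \<in> fibre_dual A m" for k \<zeta>
      using fibre_dual_linear[OF that(2)] section_in_fibre[OF U[OF that(1)], of m]
      by (simp add: linear_on_set_def)
    have "P m \<xi> \<eta> = (P m \<xi> \<eta> - P m \<eta> \<xi>) / 2"
      by (simp add: skew[OF that])
    also have "\<dots> = (\<Sum>k<n. \<xi> (U k m) / 2 * \<eta> (V k m) - \<xi> (V k m) * (\<eta> (U k m) / 2))"
      using that by (simp add: P sum_subtractf diff_divide_distrib sum_divide_distrib mult_ac)
    also have "\<dots> = (\<Sum>k<n. \<xi> ((1/2) *\<^sub>R U k m) * \<eta> (V k m) - \<xi> (V k m) * \<eta> ((1/2) *\<^sub>R U k m))"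
      using that by (intro sum.cong) (auto simp: s)
    also have "\<dots> = (\<Sum>(X, Y)\<leftarrow>?ps. \<xi> (X m) * \<eta> (Y m) - \<xi> (Y m) * \<eta> (X m))"
      by (simp add: o_def interv_sum_list_conv_sum_set_nat atLeast0LessThan)
    finally show ?thesis .
  qed
  moreover have "set ?ps \<subseteq> sections A \<times> sections A"
    using U V sections_scaleR[OF vb smooth_funs_const[OF vb]] by auto
  ultimately show ?thesis unfolding bivector_fields_def decomposes_def by blast
qed

end

text \<open>Fibrewise data and smoothness only, without any differential: this fits \<open>g\<close>
  as well as the \<open>\<omega> i\<close>, and it is unaffected when \<open>A\<close> is replaced
  by \<open>deform A N\<close>.\<close>

locale nondegenerate_form =
  fixes A :: "('m::{t2_space,second_countable_topology}, 'e::real_normed_vector, 'v::real_vector,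
               'f::real_normed_vector, 'z) vector_bundle_scheme"
    and \<omega> :: "'m \<Rightarrow> 'v \<Rightarrow> 'v \<Rightarrow> real"
  assumes vb: "vector_bundle A"
    and two_form: "\<omega> \<in> two_forms A"
    and nondegenerate: "v \<in> fibre A m \<Longrightarrow> (\<And>w. w \<in> fibre A m \<Longrightarrow> \<omega> m v w = 0) \<Longrightarrow> v = 0"

section \<open>Pointwise algebra of two-forms\<close>

context
  fixes A :: "('m::{t2_space,second_countable_topology}, 'e::real_normed_vector, 'v::real_vector,
               'f::real_normed_vector, 'z) vector_bundle_scheme"
    and \<omega> :: "'m \<Rightarrow> 'v \<Rightarrow> 'v \<Rightarrow> real"
  assumes vb: "vector_bundle A" and \<omega>: "\<omega> \<in> two_forms A"
begin

lemma two_form_add: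
  assumes "u \<in> fibre A m" "v \<in> fibre A m" "w \<in> fibre A m"
  shows "\<omega> m (u + v) w = \<omega> m u w + \<omega> m v w" "\<omega> m w (u + v) = \<omega> m w u + \<omega> m w v"
  using \<omega> assms by (auto simp: two_forms_def linear_on_set_def)

lemma two_form_scaleR:
  assumes "u \<in> fibre A m" "w \<in> fibre A m"
  shows "\<omega> m (c *\<^sub>R u) w = c * \<omega> m u w" "\<omega> m w (c *\<^sub>R u) = c * \<omega> m w u"
  using \<omega> assms by (auto simp: two_forms_def linear_on_set_def)

lemma two_form_minus:
  assumes "u \<in> fibre A m" "w \<in> fibre A m"
  shows "\<omega> m (- u) w = - \<omega> m u w" "\<omega> m w (- u) = - \<omega> m w u"
  using two_form_scaleR[OF assms, of "-1"] by auto

lemma two_form_diff: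
  assumes "u \<in> fibre A m" "v \<in> fibre A m" "w \<in> fibre A m"
  shows "\<omega> m (u - v) w = \<omega> m u w - \<omega> m v w" "\<omega> m w (u - v) = \<omega> m w u - \<omega> m w v"
  using two_form_add[of u m "- v" w] two_form_minus[of v m w] assms subspace_neg[OF subspace_fibre[OF vb]]
  by auto

text \<open>Polarization: expand \<open>\<omega> m (u + v) (u + v) = 0\<close>.\<close>

lemma two_form_skew:
  assumes "u \<in> fibre A m" "v \<in> fibre A m"
  shows "\<omega> m v u = - \<omega> m u v"
proof -
  have *: "\<omega> m w w = 0" if "w \<in> fibre A m" for w
    using \<omega> that by (auto simp: two_forms_def)
  have "u + v \<in> fibre A m" using assms subspace_add[OF subspace_fibre[OF vb]] by blast
  with two_form_add[OF assms this] two_form_add[OF assms assms(1)] two_form_add[OF assms assms(2)] * assms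
  show ?thesis by fastforce
qed

lemma two_form_smooth: "X \<in> sections A \<Longrightarrow> Y \<in> sections A \<Longrightarrow> (\<lambda>m. \<omega> m (X m) (Y m)) \<in> smooth_funs A"
  using \<omega> by (auto simp: two_forms_def)

lemma flat_dual: "v \<in> fibre A m \<Longrightarrow> flat A \<omega> m v \<in> fibre_dual A m"
  using two_form_add two_form_scaleR subspace_add[OF subspace_fibre[OF vb]] subspace_scale[OF subspace_fibre[OF vb]]
  by (auto simp: flat_def fibre_dual_def linear_on_set_def)

lemma flat_one_form: "X \<in> sections A \<Longrightarrow> (\<lambda>m. flat A \<omega> m (X m)) \<in> one_forms A"
  by (auto simp: one_forms_def flat_dual section_in_fibre) (simp add: flat_def section_in_fibre two_form_smooth)

end

context nondegenerate_form
begin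

lemma nondegenerate_eqI:
  assumes "u \<in> fibre A m" "v \<in> fibre A m" "\<And>w. w \<in> fibre A m \<Longrightarrow> \<omega> m u w = \<omega> m v w"
  shows "u = v"
  using nondegenerate[of "u - v" m] assms two_form_diff[OF vb two_form] subspace_diff[OF subspace_fibre[OF vb]]
  by fastforce

text \<open>\<open>sharp\<close> is a definite description, so uniqueness is owed. By nondegeneracy
  the covectors \<open>flat A \<omega> m w\<close> already separate the points of the fibre;
  \<open>P\<close> is arbitrary here.\<close>

lemma sharp_eqI:
  assumes "v \<in> fibre A m" "\<And>\<eta>. \<eta> \<in> fibre_dual A m \<Longrightarrow> \<eta> v = P m \<xi> \<eta>"
  shows "sharp A P m \<xi> = v"
  unfolding sharp_def
proof (rule the_equality)
  show "v \<in> fibre A m \<and> (\<forall>\<eta>\<in>fibre_dual A m. \<eta> v = P m \<xi> \<eta>)"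
    using assms by blast
next
  fix u assume u: "u \<in> fibre A m \<and> (\<forall>\<eta>\<in>fibre_dual A m. \<eta> u = P m \<xi> \<eta>)"
  show "u = v"
  proof (rule nondegenerate_eqI)
    fix w assume w: "w \<in> fibre A m"
    then have "flat A \<omega> m w u = flat A \<omega> m w v"
      using u assms flat_dual[OF vb two_form] by metis
    then show "\<omega> m u w = \<omega> m v w"
      using u assms(1) two_form_skew[OF vb two_form w, of u] two_form_skew[OF vb two_form w, of v]
      by (simp add: flat_def)
  qed (use u assms in auto)
qed

end

section \<open>The sharp map and the dual basis given by an inverse bivector field\<close>

locale invertible_form = nondegenerate_form A \<omega>
  for A :: "('m::{t2_space,second_countable_topology}, 'e::real_normed_vector, 'v::real_vector,
               'f::real_normed_vector, 'z) vector_bundle_scheme"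
    and \<omega> :: "'m \<Rightarrow> 'v \<Rightarrow> 'v \<Rightarrow> real" +
  fixes P :: "'m \<Rightarrow> ('v \<Rightarrow> real) \<Rightarrow> ('v \<Rightarrow> real) \<Rightarrow> real"
  assumes inverse: "inverse_bivector A \<omega> P"
begin

lemma bivector: "P \<in> bivector_fields A"
  using inverse by (simp add: inverse_bivector_def)

lemma sharp_expansion:
  fixes n :: nat
  assumes U: "\<And>k. k < n \<Longrightarrow> U k \<in> sections A" and V: "\<And>k. k < n \<Longrightarrow> V k \<in> sections A"
    and P: "\<And>\<eta>. \<eta> \<in> fibre_dual A m \<Longrightarrow> P m \<xi> \<eta> = (\<Sum>k<n. \<xi> (U k m) * \<eta> (V k m))"
    and \<xi>: "\<xi> \<in> fibre_dual A m"
  shows "sharp A P m \<xi> = (\<Sum>k<n. \<xi> (U k m) *\<^sub>R V k m)"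
proof (rule sharp_eqI)
  show "(\<Sum>k<n. \<xi> (U k m) *\<^sub>R V k m) \<in> fibre A m"
    using V by (auto simp: section_in_fibre intro!: subspace_sum subspace_scale subspace_fibre[OF vb])
  fix \<eta> assume \<eta>: "\<eta> \<in> fibre_dual A m"
  show "\<eta> (\<Sum>k<n. \<xi> (U k m) *\<^sub>R V k m) = P m \<xi> \<eta>"
    using V unfolding P[OF \<eta>]
    by (subst linear_on_set_sum[OF subspace_fibre[OF vb] fibre_dual_linear[OF \<eta>]]) (auto simp: section_in_fibre)
qed

text \<open>A finite expansion of \<open>P\<close> makes \<open>sharp\<close> a finite combination
  of the sections \<open>V k\<close> with coefficients \<open>\<xi> (U k m)\<close>. For a one-form
  these coefficients are smooth functions, whence the smooth section.\<close>

lemma sharp_in_fibre: "\<xi> \<in> fibre_dual A m \<Longrightarrow> sharp A P m \<xi> \<in> fibre A m"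
  and sharp_pairing: "\<xi> \<in> fibre_dual A m \<Longrightarrow> \<eta> \<in> fibre_dual A m \<Longrightarrow> \<eta> (sharp A P m \<xi>) = P m \<xi> \<eta>"
  and sharp_section: "\<alpha> \<in> one_forms A \<Longrightarrow> (\<lambda>m. sharp A P m (\<alpha> m)) \<in> sections A"
proof -
  obtain n :: nat and U V where UV: "\<And>k. k < n \<Longrightarrow> U k \<in> sections A" "\<And>k. k < n \<Longrightarrow> V k \<in> sections A"
    "\<And>m \<xi> \<eta>. \<xi> \<in> fibre_dual A m \<Longrightarrow> \<eta> \<in> fibre_dual A m \<Longrightarrow> P m \<xi> \<eta> = (\<Sum>k<n. \<xi> (U k m) * \<eta> (V k m))"
    by (rule bivector_expansion[OF vb bivector]) (rule that)
  have s: "sharp A P m \<xi> = (\<Sum>k<n. \<xi> (U k m) *\<^sub>R V k m)" if "\<xi> \<in> fibre_dual A m" for m \<xi>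
    using UV that by (intro sharp_expansion) auto
  show "sharp A P m \<xi> \<in> fibre A m" if "\<xi> \<in> fibre_dual A m"
    unfolding s[OF that] using UV
    by (auto simp: section_in_fibre intro!: subspace_sum subspace_scale subspace_fibre[OF vb])
  show "\<eta> (sharp A P m \<xi>) = P m \<xi> \<eta>" if "\<xi> \<in> fibre_dual A m" "\<eta> \<in> fibre_dual A m"
    unfolding s[OF that(1)] using UV that
    by (subst linear_on_set_sum[OF subspace_fibre[OF vb] fibre_dual_linear[OF that(2)]])
       (auto simp: section_in_fibre)
  show "(\<lambda>m. sharp A P m (\<alpha> m)) \<in> sections A" if "\<alpha> \<in> one_forms A"
    using UV that
    by (subst s[OF one_form_dual[OF that]])
       (auto intro!: sections_sum[OF vb] sections_scaleR[OF vb] intro: one_form_smooth)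
qed

lemma flat_sharp: "\<xi> \<in> fibre_dual A m \<Longrightarrow> flat A \<omega> m (sharp A P m \<xi>) = \<xi>"
  and sharp_flat: "v \<in> fibre A m \<Longrightarrow> sharp A P m (flat A \<omega> m v) = v"
  using inverse by (auto simp: inverse_bivector_def)

lemma two_form_sharp: "\<xi> \<in> fibre_dual A m \<Longrightarrow> v \<in> fibre A m \<Longrightarrow> \<omega> m (sharp A P m \<xi>) v = \<xi> v"
  using fun_cong[OF flat_sharp[of \<xi> m], of v] by (simp add: flat_def)

text \<open>The arguments are exchanged because the convention
  \<open>\<eta> (sharp \<xi>) = P \<xi> \<eta>\<close> evaluates the second covector. This is the
  source of the later minus signs.\<close>

lemma bivector_flat:
  "u \<in> fibre A m \<Longrightarrow> v \<in> fibre A m \<Longrightarrow> P m (flat A \<omega> m u) (flat A \<omega> m v) = \<omega> m v u"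
  using sharp_pairing[of "flat A \<omega> m u" m "flat A \<omega> m v"] flat_dual[OF vb two_form] sharp_flat
  by (simp add: flat_def)

text \<open>The smooth sections form a finitely generated projective module.  Here this needs no
  partition of unity: since \<open>P\<close> is a finite sum of products of sections, so is the identity.\<close>

lemma dual_basis:
  obtains n :: nat and c e where "\<And>k. k < n \<Longrightarrow> c k \<in> one_forms A" "\<And>k. k < n \<Longrightarrow> e k \<in> sections A"
    "\<And>m v. v \<in> fibre A m \<Longrightarrow> v = (\<Sum>k<n. c k m v *\<^sub>R e k m)"
proof -
  obtain n :: nat and U V where UV: "\<And>k. k < n \<Longrightarrow> U k \<in> sections A" "\<And>k. k < n \<Longrightarrow> V k \<in> sections A"
    "\<And>m \<xi> \<eta>. \<xi> \<in> fibre_dual A m \<Longrightarrow> \<eta> \<in> fibre_dual A m \<Longrightarrow> P m \<xi> \<eta> = (\<Sum>k<n. \<xi> (U k m) * \<eta> (V k m))"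
    by (rule bivector_expansion[OF vb bivector]) (rule that)
  show ?thesis
  proof (rule that)
    fix k assume "k < n"
    \<comment> \<open>The coefficient \<open>\<omega> m v (U k m)\<close> is to be a one-form in
      \<open>v\<close>; skew-symmetry makes it the flat of \<open>- U k\<close>.\<close>
    then show "(\<lambda>m. flat A \<omega> m (- U k m)) \<in> one_forms A" "V k \<in> sections A"
      using UV flat_one_form[OF vb two_form sections_minus[OF vb]] by auto
  next
    fix m v assume v: "v \<in> fibre A m"
    have "v = (\<Sum>k<n. flat A \<omega> m v (U k m) *\<^sub>R V k m)"
      using sharp_expansion[of n U V m "flat A \<omega> m v"] UV v sharp_flat flat_dual[OF vb two_form v] by auto
    also have "\<dots> = (\<Sum>k<n. flat A \<omega> m (- U k m) v *\<^sub>R V k m)"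
    proof (intro sum.cong refl)
      fix k assume "k \<in> {..<n}"
      then have "U k m \<in> fibre A m" using UV by (simp add: section_in_fibre)
      with v show "flat A \<omega> m v (U k m) *\<^sub>R V k m = flat A \<omega> m (- U k m) v *\<^sub>R V k m"
        using two_form_skew[OF vb two_form v] two_form_minus[OF vb two_form] by (simp add: flat_def)
    qed
    finally show "v = (\<Sum>k<n. flat A \<omega> m (- U k m) v *\<^sub>R V k m)" .
  qed
qed

end

subsection \<open>Algebroids without the Jacobi identity\<close>

text \<open>Without the Jacobi identity, \<open>deform A N\<close> is an instance whatever the torsion of \<open>N\<close>.\<close>

locale skew_algebroid =
  fixes A :: "('m::{t2_space,second_countable_topology}, 'e::real_normed_vector, 'v::real_vector,
               'f::real_normed_vector) lie_algebroid"
  assumes vb: "vector_bundle A"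
    and anchor_derivation: "v \<in> fibre A m \<Longrightarrow> point_derivation A m (anchor A m v)"
    and anchor_linear: "f \<in> smooth_funs A \<Longrightarrow> linear_on_set (fibre A m) (\<lambda>v. anchor A m v f)"
    and anchor_deriv_smooth: "X \<in> sections A \<Longrightarrow> f \<in> smooth_funs A \<Longrightarrow> anchor_deriv A X f \<in> smooth_funs A"
    and bracket_section: "X \<in> sections A \<Longrightarrow> Y \<in> sections A \<Longrightarrow> bracket A X Y \<in> sections A"
    and bracket_add: "X \<in> sections A \<Longrightarrow> Y \<in> sections A \<Longrightarrow> Z \<in> sections A \<Longrightarrow>
        bracket A (\<lambda>m. X m + Y m) Z = (\<lambda>m. bracket A X Z m + bracket A Y Z m)"
    and bracket_skew: "X \<in> sections A \<Longrightarrow> Y \<in> sections A \<Longrightarrow> bracket A Y X = (\<lambda>m. - bracket A X Y m)"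
    and bracket_leibniz: "X \<in> sections A \<Longrightarrow> Y \<in> sections A \<Longrightarrow> f \<in> smooth_funs A \<Longrightarrow>
        bracket A X (\<lambda>m. f m *\<^sub>R Y m) = (\<lambda>m. f m *\<^sub>R bracket A X Y m + anchor_deriv A X f m *\<^sub>R Y m)"
begin

lemma bracket_in_fibre: "X \<in> sections A \<Longrightarrow> Y \<in> sections A \<Longrightarrow> bracket A X Y m \<in> fibre A m"
  by (rule section_in_fibre[OF bracket_section])

lemma anchor_deriv_add:
  "X \<in> sections A \<Longrightarrow> f \<in> smooth_funs A \<Longrightarrow> g \<in> smooth_funs A \<Longrightarrow>
    anchor_deriv A X (\<lambda>x. f x + g x) m = anchor_deriv A X f m + anchor_deriv A X g m"
  using anchor_derivation[OF section_in_fibre] by (simp add: point_derivation_def anchor_deriv_def)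

lemma anchor_deriv_mult:
  "X \<in> sections A \<Longrightarrow> f \<in> smooth_funs A \<Longrightarrow> g \<in> smooth_funs A \<Longrightarrow>
    anchor_deriv A X (\<lambda>x. f x * g x) m = anchor_deriv A X f m * g m + f m * anchor_deriv A X g m"
  using anchor_derivation[OF section_in_fibre] by (simp add: point_derivation_def anchor_deriv_def)

lemma anchor_deriv_cmult:
  "X \<in> sections A \<Longrightarrow> f \<in> smooth_funs A \<Longrightarrow>
    anchor_deriv A X (\<lambda>x. c * f x) m = c * anchor_deriv A X f m"
  using anchor_derivation[OF section_in_fibre] by (simp add: point_derivation_def anchor_deriv_def)

lemma anchor_deriv_minus:
  "X \<in> sections A \<Longrightarrow> f \<in> smooth_funs A \<Longrightarrow> anchor_deriv A X (\<lambda>x. - f x) m = - anchor_deriv A X f m"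
  using anchor_deriv_cmult[of X f "-1"] by simp

lemma anchor_deriv_zero: "X \<in> sections A \<Longrightarrow> anchor_deriv A X (\<lambda>x. 0) m = 0"
  using anchor_deriv_cmult[of X "\<lambda>x. 0" 0 m] smooth_funs_const[OF vb, of 0] by simp

lemma anchor_deriv_sum:
  assumes "X \<in> sections A"
  shows "finite I \<Longrightarrow> (\<And>k. k \<in> I \<Longrightarrow> f k \<in> smooth_funs A) \<Longrightarrow>
    anchor_deriv A X (\<lambda>x. \<Sum>k\<in>I. f k x) m = (\<Sum>k\<in>I. anchor_deriv A X (f k) m)"
  by (induction I rule: finite_induct)
    (auto simp: assms anchor_deriv_zero anchor_deriv_add smooth_funs_sum[OF vb])

lemma bracket_add_right:
  assumes "X \<in> sections A" "Y \<in> sections A" "Z \<in> sections A"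
  shows "bracket A X (\<lambda>m. Y m + Z m) m = bracket A X Y m + bracket A X Z m"
  using assms bracket_skew[of "\<lambda>m. Y m + Z m" X] bracket_add[of Y Z X] bracket_skew[of Y X]
    bracket_skew[of Z X] sections_add[OF vb, of Y Z] by simp

lemma bracket_zero_right: "X \<in> sections A \<Longrightarrow> bracket A X (\<lambda>m. 0) m = 0"
  using bracket_add_right[of X "\<lambda>m. 0" "\<lambda>m. 0" m] sections_zero[OF vb] by simp

lemma bracket_sum_right:
  assumes X: "X \<in> sections A"
  shows "finite I \<Longrightarrow> (\<And>k. k \<in> I \<Longrightarrow> f k \<in> smooth_funs A) \<Longrightarrow> (\<And>k. k \<in> I \<Longrightarrow> Y k \<in> sections A) \<Longrightarrow>
    bracket A X (\<lambda>x. \<Sum>k\<in>I. f k x *\<^sub>R Y k x) m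
      = (\<Sum>k\<in>I. f k m *\<^sub>R bracket A X (Y k) m + anchor_deriv A X (f k) m *\<^sub>R Y k m)"
proof (induction I rule: finite_induct)
  case empty
  then show ?case by (simp add: X bracket_zero_right)
next
  case (insert k I)
  have "(\<lambda>x. f k x *\<^sub>R Y k x) \<in> sections A" "(\<lambda>x. \<Sum>k\<in>I. f k x *\<^sub>R Y k x) \<in> sections A"
    using insert by (auto intro!: sections_sum[OF vb] sections_scaleR[OF vb])
  then show ?case using insert X by (simp add: bracket_add_right bracket_leibniz)
qed

text \<open>The cyclic form of the differential, which matches the alternating sum over the slots of
  \<open>wedge3\<close>.\<close>

lemma d_two_form_alt:
  assumes "\<omega> \<in> two_forms A" "X \<in> sections A" "Y \<in> sections A" "Z \<in> sections A"
  shows "d_two_form A \<omega> X Y Z m =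
     anchor_deriv A X (\<lambda>x. \<omega> x (Y x) (Z x)) m + anchor_deriv A Y (\<lambda>x. \<omega> x (Z x) (X x)) m
     + anchor_deriv A Z (\<lambda>x. \<omega> x (X x) (Y x)) m
     - \<omega> m (bracket A X Y m) (Z m) - \<omega> m (bracket A Y Z m) (X m) - \<omega> m (bracket A Z X m) (Y m)"
proof -
  have "(\<lambda>x. \<omega> x (Z x) (X x)) = (\<lambda>x. - \<omega> x (X x) (Z x))"
    using assms by (intro ext two_form_skew[OF vb]) (auto simp: section_in_fibre)
  with assms show ?thesis
    by (simp add: d_two_form_def anchor_deriv_minus two_form_smooth[OF vb] bracket_skew[of X Z]
        two_form_minus[OF vb] bracket_in_fibre section_in_fibre)
qed

lemma skew_algebroid_deform:
  assumes N: "N \<in> endomorphisms A"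
  shows "skew_algebroid (deform A N)"
proof -
  have [simp]: "fibre (deform A N) = fibre A" "smooth_funs (deform A N) = smooth_funs A"
    "sections (deform A N) = sections A" "vector_bundle (deform A N)"
    "point_derivation (deform A N) = point_derivation A"
    using vb by (simp_all add: deform_def smooth_funs_def sections_def vector_bundle_def
        point_derivation_def fun_eq_iff)
  have [simp]: "anchor_deriv (deform A N) X f = anchor_deriv A (\<lambda>m. N m (X m)) f" for X f
    by (simp add: anchor_deriv_def deform_def)
  have [simp]: "bracket (deform A N) = deformed_bracket A N" "anchor (deform A N) m v = anchor A m (N m v)" for m v
    by (simp_all add: deform_def)
  note [simp] = N endomorphism_section[OF N] section_in_fibre endomorphism_in_fibre[OF N] bracket_section bracket_in_fibre
  have N_add: "N m (u + v) = N m u + N m v" if "u \<in> fibre A m" "v \<in> fibre A m" for u v m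
    using endomorphism_linear[OF N, of m] that by (auto simp: linear_on_set_def)
  have N_scaleR: "N m (c *\<^sub>R u) = c *\<^sub>R N m u" if "u \<in> fibre A m" for u m c
    using endomorphism_linear[OF N, of m] that by (auto simp: linear_on_set_def)
  have N_minus: "N m (- u) = - N m u" if "u \<in> fibre A m" for u m
    using N_scaleR[OF that, of "-1"] by simp
  show ?thesis
  proof unfold_locales
    show "linear_on_set (fibre (deform A N) m) (\<lambda>v. anchor (deform A N) m v f)"
      if "f \<in> smooth_funs (deform A N)" for f m
      using anchor_linear[of f m] that N_add N_scaleR by (simp add: linear_on_set_def)
    fix X Y Z f assume *: "X \<in> sections (deform A N)" "Y \<in> sections (deform A N)"
    then have XY: "X \<in> sections A" "Y \<in> sections A" by simp_all
    show "bracket (deform A N) X Y \<in> sections (deform A N)"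
      using XY sections_add[OF vb sections_add[OF vb], of "bracket A (\<lambda>m. N m (X m)) Y" "bracket A X (\<lambda>m. N m (Y m))"
          "\<lambda>m. - N m (bracket A X Y m)"] sections_minus[OF vb, of "\<lambda>m. N m (bracket A X Y m)"]
      by (simp add: deformed_bracket_def[abs_def])
    show "bracket (deform A N) Y X = (\<lambda>m. - bracket (deform A N) X Y m)"
      using XY bracket_skew[of "\<lambda>m. N m (X m)" Y] bracket_skew[of X "\<lambda>m. N m (Y m)"] bracket_skew[of X Y]
      by (simp add: deformed_bracket_def fun_eq_iff N_minus)
    show "bracket (deform A N) (\<lambda>m. X m + Y m) Z =
        (\<lambda>m. bracket (deform A N) X Z m + bracket (deform A N) Y Z m)" if "Z \<in> sections (deform A N)"
      using XY that
        bracket_add[of "\<lambda>m. N m (X m)" "\<lambda>m. N m (Y m)" Z] bracket_add[of X Y Z] bracket_add[of X Y "\<lambda>m. N m (Z m)"]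
      by (simp add: deformed_bracket_def fun_eq_iff N_add)
    show "bracket (deform A N) X (\<lambda>m. f m *\<^sub>R Y m) = (\<lambda>m. f m *\<^sub>R bracket (deform A N) X Y m
        + anchor_deriv (deform A N) X f m *\<^sub>R Y m)" if "f \<in> smooth_funs (deform A N)"
    proof -
      have "N m (f m *\<^sub>R Y m) = f m *\<^sub>R N m (Y m)" for m
        using XY N_scaleR by auto
      \<comment> \<open>The term \<open>anchor_deriv A X f m *\<^sub>R N m (Y m)\<close> occurs here
        and in the bracket of \<open>X\<close> with \<open>f\<close> times \<open>N Y\<close>. In
        the deformed bracket the two cancel, and only the derivative along \<open>N X\<close>
        survives, as the deformed anchor demands.\<close>
      moreover have "N m (bracket A X (\<lambda>m. f m *\<^sub>R Y m) m)
          = f m *\<^sub>R N m (bracket A X Y m) + anchor_deriv A X f m *\<^sub>R N m (Y m)" for m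
        using XY that bracket_leibniz[of X Y f] subspace_scale[OF subspace_fibre[OF vb]]
        by (simp add: N_add N_scaleR)
      ultimately show ?thesis
        using XY that bracket_leibniz[of X "\<lambda>m. N m (Y m)" f] bracket_leibniz[of "\<lambda>m. N m (X m)" Y f]
        by (simp add: deformed_bracket_def fun_eq_iff algebra_simps)
    qed
  qed (auto simp: anchor_derivation anchor_deriv_smooth)
qed

end

lemma skew_algebroid_of_lie_algebroid: "lie_algebroid A \<Longrightarrow> skew_algebroid A"
proof -
  assume "lie_algebroid A"
  note c1 = this[unfolded lie_algebroid_def]
  note c2 = c1[THEN conjunct2]
  note c3 = c2[THEN conjunct2]
  note c4 = c3[THEN conjunct2]
  note c5 = c4[THEN conjunct2]
  note c6 = c5[THEN conjunct2]
  note c8 = c6[THEN conjunct2, THEN conjunct2]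
  note c10 = c8[THEN conjunct2, THEN conjunct2]
  note c = c1[THEN conjunct1] c2[THEN conjunct1, rule_format] c3[THEN conjunct1, rule_format]
    c4[THEN conjunct1, rule_format] c5[THEN conjunct1, rule_format] c6[THEN conjunct1, rule_format]
    c8[THEN conjunct1, rule_format] c10[rule_format]
  show "skew_algebroid A" by (rule skew_algebroid.intro; rule c; assumption)
qed

text \<open>Closedness of \<open>\<omega>\<close> is stated separately wherever it enters, so that
  \<open>deform A N\<close> with the same \<open>\<omega>\<close> and \<open>P\<close> is an
  instance before its differential has been computed.\<close>

locale symplectic_pair = skew_algebroid A + invertible_form A \<omega> P
  for A :: "('m::{t2_space,second_countable_topology}, 'e::real_normed_vector, 'v::real_vector,
               'f::real_normed_vector) lie_algebroid"
    and \<omega> :: "'m \<Rightarrow> 'v \<Rightarrow> 'v \<Rightarrow> real" and P :: "'m \<Rightarrow> ('v \<Rightarrow> real) \<Rightarrow> ('v \<Rightarrow> real) \<Rightarrow> real"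
begin

text \<open>The dual basis coefficients are frozen at their values on \<open>v\<close>; the
  resulting constant combination of the \<open>e k\<close> is a global section.\<close>

lemma section_through:
  assumes "v \<in> fibre A m"
  obtains X where "X \<in> sections A" "X m = v"
proof -
  obtain n :: nat and c e where ce: "\<And>k. k < n \<Longrightarrow> e k \<in> sections A"
    "\<And>m v. v \<in> fibre A m \<Longrightarrow> v = (\<Sum>k<n. c k m v *\<^sub>R e k m)"
    by (rule dual_basis) (rule that)
  have "(\<lambda>x. \<Sum>k<n. c k m v *\<^sub>R e k x) \<in> sections A"
    using ce(1) by (auto intro!: sections_sum[OF vb] sections_scaleR[OF vb] smooth_funs_const[OF vb])
  with that ce(2)[OF assms] show ?thesis by metis
qed

section \<open>One-forms and the Lie derivative\<close>

lemma one_form_eqI: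
  assumes "\<alpha> \<in> one_forms A" "\<beta> \<in> one_forms A" "\<And>X m. X \<in> sections A \<Longrightarrow> \<alpha> m (X m) = \<beta> m (X m)"
  shows "\<alpha> = \<beta>"
proof (intro ext)
  fix m v
  show "\<alpha> m v = \<beta> m v"
  proof (cases "v \<in> fibre A m")
    case True
    then show ?thesis using section_through assms(3) by metis
  next
    case False
    then show ?thesis
      using one_form_dual[OF assms(1), of m] one_form_dual[OF assms(2), of m] by (simp add: fibre_dual_def)
  qed
qed

text \<open>Provides existence for the definite description in \<open>lie_deriv\<close>. Linearity
  over the smooth functions forces \<open>\<gamma>\<close> to be the sum of the \<open>c k\<close>
  weighted by \<open>F (e k)\<close>.\<close>

lemma one_form_of_tensorial:
  assumes smooth: "\<And>Y. Y \<in> sections A \<Longrightarrow> F Y \<in> smooth_funs A"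
    and add: "\<And>Y Z m. Y \<in> sections A \<Longrightarrow> Z \<in> sections A \<Longrightarrow> F (\<lambda>m. Y m + Z m) m = F Y m + F Z m"
    and scaleR: "\<And>f Y m. f \<in> smooth_funs A \<Longrightarrow> Y \<in> sections A \<Longrightarrow> F (\<lambda>m. f m *\<^sub>R Y m) m = f m * F Y m"
  obtains \<gamma> where "\<gamma> \<in> one_forms A" "\<And>Y m. Y \<in> sections A \<Longrightarrow> \<gamma> m (Y m) = F Y m"
proof -
  obtain n :: nat and c e where c: "\<And>k. k < n \<Longrightarrow> c k \<in> one_forms A" and e: "\<And>k. k < n \<Longrightarrow> e k \<in> sections A"
    and ce: "\<And>m v. v \<in> fibre A m \<Longrightarrow> v = (\<Sum>k<n. c k m v *\<^sub>R e k m)"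
    by (rule dual_basis) (rule that)
  define \<gamma> where "\<gamma> m v = (\<Sum>k<n. c k m v * F (e k) m)" for m v
  have zero: "F (\<lambda>m. 0) m = 0" for m
    using add[OF sections_zero[OF vb] sections_zero[OF vb], of m] by simp
  have F_sum: "finite I \<Longrightarrow> (\<And>k. k \<in> I \<Longrightarrow> f k \<in> smooth_funs A \<and> Y k \<in> sections A) \<Longrightarrow>
      F (\<lambda>x. \<Sum>k\<in>I. f k x *\<^sub>R Y k x) m = (\<Sum>k\<in>I. f k m * F (Y k) m)" for I f Y m
  proof (induction I rule: finite_induct)
    case empty
    then show ?case by (simp add: zero)
  next
    case (insert k I)
    then have "(\<lambda>x. f k x *\<^sub>R Y k x) \<in> sections A" "(\<lambda>x. \<Sum>k\<in>I. f k x *\<^sub>R Y k x) \<in> sections A"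
      by (auto intro!: sections_sum[OF vb] sections_scaleR[OF vb])
    then show ?case using insert by (simp add: add scaleR)
  qed
  have eq: "\<gamma> m (Y m) = F Y m" if Y: "Y \<in> sections A" for Y m
  proof -
    have "F Y m = F (\<lambda>x. \<Sum>k<n. c k x (Y x) *\<^sub>R e k x) m"
      using ce[OF section_in_fibre[OF Y]] by presburger
    also have "\<dots> = \<gamma> m (Y m)"
      using c e one_form_smooth[OF _ Y] by (subst F_sum) (auto simp: \<gamma>_def)
    finally show ?thesis by simp
  qed
  have "\<gamma> m \<in> fibre_dual A m" for m
    using one_form_dual[OF c, of _ m]
    by (auto simp: \<gamma>_def[abs_def] fibre_dual_def linear_on_set_def sum.distrib sum_distrib_left algebra_simps
        intro!: sum.neutral)
  moreover have "(\<lambda>m. \<gamma> m (Y m)) \<in> smooth_funs A" if "Y \<in> sections A" for Y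
    using smooth[OF that] by (simp add: eq[OF that])
  ultimately have "\<gamma> \<in> one_forms A" by (simp add: one_forms_def)
  with that eq show ?thesis by blast
qed

text \<open>The formula defining \<open>lie_deriv\<close> is tensorial: for \<open>f\<close> times
  \<open>Y\<close>, the derivative of \<open>f\<close> enters through the product rule and through
  the Leibniz rule with opposite signs.\<close>

lemma
  assumes X: "X \<in> sections A" and \<beta>: "\<beta> \<in> one_forms A"
  shows lie_deriv_one_form: "lie_deriv A X \<beta> \<in> one_forms A"
    and lie_deriv_pairing: "Y \<in> sections A \<Longrightarrow>
      lie_deriv A X \<beta> m (Y m) = anchor_deriv A X (\<lambda>x. \<beta> x (Y x)) m - \<beta> m (bracket A X Y m)"
proof -
  define F where "F Y m = anchor_deriv A X (\<lambda>x. \<beta> x (Y x)) m - \<beta> m (bracket A X Y m)" for Y m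
  have l: "linear_on_set (fibre A m) (\<beta> m)" for m
    by (rule fibre_dual_linear[OF one_form_dual[OF \<beta>]])
  obtain \<gamma> where \<gamma>: "\<gamma> \<in> one_forms A" "\<And>Y m. Y \<in> sections A \<Longrightarrow> \<gamma> m (Y m) = F Y m"
  proof (rule one_form_of_tensorial)
    fix Y assume Y: "Y \<in> sections A"
    show "F Y \<in> smooth_funs A"
      using smooth_funs_add[OF vb anchor_deriv_smooth[OF X one_form_smooth[OF \<beta> Y]]
          smooth_funs_minus[OF vb one_form_smooth[OF \<beta> bracket_section[OF X Y]]]]
      by (simp add: F_def[abs_def])
    show "F (\<lambda>m. Y m + Z m) m = F Y m + F Z m" if Z: "Z \<in> sections A" for Z m
      using Y Z l[unfolded linear_on_set_def] bracket_add_right[OF X Y Z]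
        anchor_deriv_add[OF X one_form_smooth[OF \<beta> Y] one_form_smooth[OF \<beta> Z]]
      by (simp add: F_def section_in_fibre bracket_in_fibre X)
    show "F (\<lambda>m. f m *\<^sub>R Y m) m = f m * F Y m" if f: "f \<in> smooth_funs A" for f m
      using Y f l[unfolded linear_on_set_def] bracket_leibniz[OF X Y f] subspace_scale[OF subspace_fibre[OF vb]]
        anchor_deriv_mult[OF X f one_form_smooth[OF \<beta> Y]]
      by (simp add: F_def section_in_fibre bracket_in_fibre X algebra_simps)
  qed (rule that)
  have "lie_deriv A X \<beta> = \<gamma>"
    unfolding lie_deriv_def
  proof (rule the_equality)
    show "\<gamma> \<in> one_forms A \<and> (\<forall>Y\<in>sections A. \<forall>m. \<gamma> m (Y m) = anchor_deriv A X (\<lambda>x. \<beta> x (Y x)) m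
        - \<beta> m (bracket A X Y m))"
      using \<gamma> by (simp add: F_def)
  next
    fix \<gamma>' assume "\<gamma>' \<in> one_forms A \<and> (\<forall>Y\<in>sections A. \<forall>m. \<gamma>' m (Y m) = anchor_deriv A X (\<lambda>x. \<beta> x (Y x)) m
        - \<beta> m (bracket A X Y m))"
    with \<gamma> show "\<gamma>' = \<gamma>" by (intro one_form_eqI) (auto simp: F_def)
  qed
  with \<gamma> show "lie_deriv A X \<beta> \<in> one_forms A"
    and "Y \<in> sections A \<Longrightarrow>
      lie_deriv A X \<beta> m (Y m) = anchor_deriv A X (\<lambda>x. \<beta> x (Y x)) m - \<beta> m (bracket A X Y m)"
    by (simp_all add: F_def)
qed

text \<open>The concomitant has to vanish as a function on all of \<open>'v\<close>, so vectors
  outside the fibre need a check of their own.\<close>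

lemma form_bracket_outside:
  assumes "X \<in> sections A" "Y \<in> sections A" "v \<notin> fibre A m"
  shows "form_bracket A P (\<lambda>x. flat A \<omega> x (X x)) (\<lambda>x. flat A \<omega> x (Y x)) m v = 0"
proof -
  have 0: "lie_deriv A Z \<alpha> m v = 0" if "Z \<in> sections A" "\<alpha> \<in> one_forms A" for Z \<alpha>
    using one_form_dual[OF lie_deriv_one_form[OF that], of m] assms(3) by (simp add: fibre_dual_def)
  show ?thesis
    using assms by (simp add: form_bracket_def d_fun_def sharp_flat section_in_fibre 0 flat_one_form[OF vb two_form])
qed

text \<open>For closed \<open>\<omega>\<close> the isomorphism \<open>\<omega>\<^sup>\<flat>\<close> carries the bracket of \<open>A\<close> to the bracket of forms.\<close>

lemma form_bracket_flat:
  assumes X: "X \<in> sections A" and Y: "Y \<in> sections A" and Z: "Z \<in> sections A"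
  shows "form_bracket A P (\<lambda>x. flat A \<omega> x (X x)) (\<lambda>x. flat A \<omega> x (Y x)) m (Z m)
    = d_two_form A \<omega> X Y Z m + \<omega> m (bracket A X Y m) (Z m)"
proof -
  note XYZ = X Y Z
  have "(\<lambda>x. P x (flat A \<omega> x (X x)) (flat A \<omega> x (Y x))) = (\<lambda>x. - \<omega> x (X x) (Y x))"
    using X Y two_form_skew[OF vb two_form section_in_fibre[OF X] section_in_fibre[OF Y]]
    by (simp add: bivector_flat section_in_fibre)
  then have "d_fun A (\<lambda>x. P x (flat A \<omega> x (X x)) (flat A \<omega> x (Y x))) m (Z m)
      = - anchor_deriv A Z (\<lambda>x. \<omega> x (X x) (Y x)) m"
    using anchor_deriv_minus[OF Z two_form_smooth[OF vb two_form X Y]] Z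
    by (simp add: d_fun_def section_in_fibre anchor_deriv_def)
  moreover have "lie_deriv A U (\<lambda>x. flat A \<omega> x (V x)) m (Z m)
      = anchor_deriv A U (\<lambda>x. \<omega> x (V x) (Z x)) m + \<omega> m (bracket A U Z m) (V m)"
    if "U \<in> sections A" "V \<in> sections A" for U V
    using that Z two_form_skew[OF vb two_form section_in_fibre[OF that(2)] bracket_in_fibre[OF that(1) Z]]
    by (simp add: lie_deriv_pairing flat_one_form[OF vb two_form]) (simp add: flat_def section_in_fibre bracket_in_fibre)
  ultimately show ?thesis
    using XYZ by (simp add: form_bracket_def sharp_flat section_in_fibre d_two_form_def)
qed

end

subsection \<open>Poisson-Nijenhuis structures from pairs of closed forms\<close>

text \<open>\<open>\<omega>N\<close> is a parameter tied to \<open>\<omega>\<close> and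
  \<open>N\<close> on the fibres only: the forms substituted for it later have unspecified values
  elsewhere.\<close>

locale compatible_endomorphism = skew_algebroid A
  for A :: "('m::{t2_space,second_countable_topology}, 'e::real_normed_vector, 'v::real_vector,
               'f::real_normed_vector) lie_algebroid" +
  fixes \<omega> \<omega>N :: "'m \<Rightarrow> 'v \<Rightarrow> 'v \<Rightarrow> real" and N :: "'m \<Rightarrow> 'v \<Rightarrow> 'v"
  assumes N: "N \<in> endomorphisms A"
    and form: "\<omega> \<in> two_forms A" and formN: "\<omega>N \<in> two_forms A"
    and formN_eq: "u \<in> fibre A m \<Longrightarrow> v \<in> fibre A m \<Longrightarrow> \<omega>N m u v = \<omega> m (N m u) v"
begin

text \<open>Compare the skew-symmetry of \<open>\<omega>\<close> with that of
  \<open>\<omega>N\<close>.\<close>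

lemma form_symmetric:
  assumes "u \<in> fibre A m" "v \<in> fibre A m"
  shows "\<omega> m u (N m v) = \<omega> m (N m u) v"
  using two_form_skew[OF vb form endomorphism_in_fibre[OF N assms(2)] assms(1)]
    two_form_skew[OF vb formN assms] formN_eq assms by simp

lemma N_add: "u \<in> fibre A m \<Longrightarrow> v \<in> fibre A m \<Longrightarrow> N m (u + v) = N m u + N m v"
  using endomorphism_linear[OF N, of m] by (simp add: linear_on_set_def)

lemma N_diff: "u \<in> fibre A m \<Longrightarrow> v \<in> fibre A m \<Longrightarrow> N m (u - v) = N m u - N m v"
  using N_add[of u m "- v"] linear_on_set_minus[OF endomorphism_linear[OF N], of v m]
    subspace_neg[OF subspace_fibre[OF vb]] by fastforce

lemmas fibre_closed = section_in_fibre bracket_in_fibre endomorphism_in_fibre[OF N] endomorphism_section[OF N]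
  subspace_add[OF subspace_fibre[OF vb]] subspace_diff[OF subspace_fibre[OF vb]]
  subspace_scale[OF subspace_fibre[OF vb]]

text \<open>After \<open>N\<close> has been moved between the slots by symmetry, all anchor terms
  and all brackets with \<open>Z\<close> cancel. The four remaining brackets of \<open>X\<close> and
  \<open>Y\<close> form the torsion, with \<open>e\<close> coming from the square of
  \<open>N\<close>.\<close>

lemma torsion_identity:
  assumes sq: "\<And>m v. v \<in> fibre A m \<Longrightarrow> N m (N m v) = e *\<^sub>R v"
    and XYZ: "X \<in> sections A" "Y \<in> sections A" "Z \<in> sections A"
  shows "\<omega> m (torsion A N X Y m) (Z m) =
    d_two_form A \<omega>N (\<lambda>x. N x (X x)) Y Z m + d_two_form A \<omega>N X (\<lambda>x. N x (Y x)) Z m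
    - d_two_form A \<omega> (\<lambda>x. N x (X x)) (\<lambda>x. N x (Y x)) Z m - e * d_two_form A \<omega> X Y Z m"
  using XYZ
  by (simp add: d_two_form_def torsion_def deformed_bracket_def formN_eq form_symmetric sq N_add N_diff
      fibre_closed two_form_add[OF vb form] two_form_diff[OF vb form] two_form_scaleR[OF vb form]
      anchor_deriv_cmult two_form_smooth[OF vb form] algebra_simps)

text \<open>A term such as the derivative along \<open>X\<close> of \<open>\<omega>N\<close> on
  \<open>Y\<close> and \<open>Z\<close> occurs twice, with \<open>N\<close> placed on
  \<open>Y\<close> and on \<open>Z\<close>; hence the factor 2 in the correction.\<close>

lemma d_two_form_deform:
  assumes XYZ: "X \<in> sections A" "Y \<in> sections A" "Z \<in> sections A"
  shows "d_two_form (deform A N) \<omega> X Y Z m =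
    d_two_form A \<omega> (\<lambda>x. N x (X x)) Y Z m + d_two_form A \<omega> X (\<lambda>x. N x (Y x)) Z m
    + d_two_form A \<omega> X Y (\<lambda>x. N x (Z x)) m - 2 * d_two_form A \<omega>N X Y Z m"
proof -
  have "anchor_deriv (deform A N) X f = anchor_deriv A (\<lambda>m. N m (X m)) f" for X f
    by (simp add: anchor_deriv_def deform_def)
  moreover have "bracket (deform A N) = deformed_bracket A N"
    by (simp add: deform_def)
  ultimately show ?thesis using XYZ
    by (simp add: d_two_form_def deformed_bracket_def formN_eq form_symmetric N_add N_diff
      fibre_closed two_form_add[OF vb form] two_form_diff[OF vb form] algebra_simps)
qed

end

section \<open>Torsion, deformation and the Magri-Morosi concomitant\<close>

context symplectic_pair
begin

lemma torsion_zero: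
  assumes "compatible_endomorphism A \<omega> \<omega>N N"
    and closed: "\<And>X Y Z m. X \<in> sections A \<Longrightarrow> Y \<in> sections A \<Longrightarrow> Z \<in> sections A \<Longrightarrow> d_two_form A \<omega> X Y Z m = 0"
      "\<And>X Y Z m. X \<in> sections A \<Longrightarrow> Y \<in> sections A \<Longrightarrow> Z \<in> sections A \<Longrightarrow> d_two_form A \<omega>N X Y Z m = 0"
    and sq: "\<And>m v. v \<in> fibre A m \<Longrightarrow> N m (N m v) = e *\<^sub>R v"
    and XY: "X \<in> sections A" "Y \<in> sections A"
  shows "torsion A N X Y = (\<lambda>m. 0)"
proof
  fix m
  interpret c: compatible_endomorphism A \<omega> \<omega>N N by fact
  show "torsion A N X Y m = 0"
  proof (rule nondegenerate)
    show "torsion A N X Y m \<in> fibre A m"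
      using XY by (simp add: torsion_def deformed_bracket_def c.fibre_closed)
    fix w assume "w \<in> fibre A m"
    then obtain Z where "Z \<in> sections A" "Z m = w" by (rule section_through)
    with c.torsion_identity[OF sq XY, of Z m] closed XY show "\<omega> m (torsion A N X Y m) w = 0"
      by (simp add: c.fibre_closed)
  qed
qed

text \<open>\<open>deform\<close> alters only bracket and anchor, whereas the conditions on
  \<open>\<omega>\<close> and \<open>P\<close> concern the underlying bundle.\<close>

lemma symplectic_pair_deform:
  assumes "N \<in> endomorphisms A"
  shows "symplectic_pair (deform A N) \<omega> P"
proof -
  have [simp]: "fibre (deform A N) = fibre A" "sections (deform A N) = sections A"
    "smooth_funs (deform A N) = smooth_funs A" "fibre_dual (deform A N) = fibre_dual A"
    "flat (deform A N) = flat A" "sharp (deform A N) = sharp A"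
    by (simp_all add: deform_def smooth_funs_def sections_def fibre_dual_def fun_eq_iff flat_def sharp_def)
  have [simp]: "decomposes (deform A N) = decomposes A"
    by (simp add: decomposes_def fun_eq_iff)
  interpret d: skew_algebroid "deform A N" by (rule skew_algebroid_deform[OF assms])
  show ?thesis
    using two_form nondegenerate inverse
    by unfold_locales (simp_all add: d.vb two_forms_def inverse_bivector_def bivector_fields_def)
qed

lemma magri_morosi_zero:
  assumes "compatible_endomorphism A \<omega> \<omega>N N"
    and closed: "\<And>X Y Z m. X \<in> sections A \<Longrightarrow> Y \<in> sections A \<Longrightarrow> Z \<in> sections A \<Longrightarrow> d_two_form A \<omega> X Y Z m = 0"
      "\<And>X Y Z m. X \<in> sections A \<Longrightarrow> Y \<in> sections A \<Longrightarrow> Z \<in> sections A \<Longrightarrow> d_two_form A \<omega>N X Y Z m = 0"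
    and \<alpha>: "\<alpha> \<in> one_forms A" and \<beta>: "\<beta> \<in> one_forms A"
  shows "magri_morosi A P N \<alpha> \<beta> = (\<lambda>m v. 0)"
proof -
  interpret c: compatible_endomorphism A \<omega> \<omega>N N by fact
  interpret d: symplectic_pair "deform A N" \<omega> P by (rule symplectic_pair_deform[OF c.N])
  have [simp]: "fibre (deform A N) = fibre A" "sections (deform A N) = sections A"
    "flat (deform A N) = flat A" "bracket (deform A N) = deformed_bracket A N"
    by (simp_all add: deform_def sections_def fun_eq_iff flat_def)
  define X where "X m = sharp A P m (\<alpha> m)" for m
  define Y where "Y m = sharp A P m (\<beta> m)" for m
  have XY: "X \<in> sections A" "Y \<in> sections A"
    using sharp_section[OF \<alpha>] sharp_section[OF \<beta>] by (simp_all add: X_def[abs_def] Y_def[abs_def])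
  \<comment> \<open>Every one-form is the flat of a section, which makes
    \<open>form_bracket_flat\<close> applicable to all brackets in the concomitant.\<close>
  have \<alpha>_eq: "\<alpha> = (\<lambda>m. flat A \<omega> m (X m))" and \<beta>_eq: "\<beta> = (\<lambda>m. flat A \<omega> m (Y m))"
    using flat_sharp one_form_dual[OF \<alpha>] one_form_dual[OF \<beta>] by (simp_all add: X_def Y_def)
  have transpose: "transpose_endo A N m (flat A \<omega> m u) = flat A \<omega> m (N m u)" if "u \<in> fibre A m" for m u
    using that by (auto simp: transpose_endo_def flat_def c.fibre_closed c.form_symmetric)
  show ?thesis
  proof (intro ext)
    fix m v
    show "magri_morosi A P N \<alpha> \<beta> m v = 0"
    proof (cases "v \<in> fibre A m")
      case True
      then obtain Z where Z: "Z \<in> sections A" "Z m = v" by (rule section_through)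
      \<comment> \<open>The differential of \<open>\<omega>\<close> for the deformed bracket
        vanishes by \<open>d_two_form_deform\<close>, so only the bracket term is left.\<close>
      have "form_bracket (deform A N) P \<alpha> \<beta> m v = \<omega> m (deformed_bracket A N X Y m) v"
        using d.form_bracket_flat[of X Y Z m] XY Z closed
        by (simp add: \<alpha>_eq \<beta>_eq c.d_two_form_deform c.fibre_closed)
      moreover have "form_bracket A P (\<lambda>x. transpose_endo A N x (\<alpha> x)) \<beta> m v
          = \<omega> m (bracket A (\<lambda>x. N x (X x)) Y m) v"
        using form_bracket_flat[of "\<lambda>x. N x (X x)" Y Z m] XY Z closed
        by (simp add: \<alpha>_eq \<beta>_eq transpose c.fibre_closed)
      moreover have "form_bracket A P \<alpha> (\<lambda>x. transpose_endo A N x (\<beta> x)) m v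
          = \<omega> m (bracket A X (\<lambda>x. N x (Y x)) m) v"
        using form_bracket_flat[of X "\<lambda>x. N x (Y x)" Z m] XY Z closed
        by (simp add: \<alpha>_eq \<beta>_eq transpose c.fibre_closed)
      \<comment> \<open>The transpose puts \<open>N\<close> on the test section, and symmetry moves
        it back onto the bracket.\<close>
      moreover have "transpose_endo A N m (form_bracket A P \<alpha> \<beta> m) v = \<omega> m (N m (bracket A X Y m)) v"
        using form_bracket_flat[of X Y "\<lambda>x. N x (Z x)" m] XY Z closed
        by (simp add: \<alpha>_eq \<beta>_eq transpose_endo_def c.fibre_closed c.form_symmetric True)
      ultimately show ?thesis
        using XY True
        by (simp add: magri_morosi_def deformed_bracket_def c.fibre_closed two_form_add[OF vb two_form]
            two_form_diff[OF vb two_form])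
    next
      case False
      have "form_bracket (deform A N) P \<alpha> \<beta> m v = 0"
        using d.form_bracket_outside[of X Y v m] XY False by (simp add: \<alpha>_eq \<beta>_eq)
      moreover have "form_bracket A P (\<lambda>x. transpose_endo A N x (\<alpha> x)) \<beta> m v = 0"
        using form_bracket_outside[of "\<lambda>x. N x (X x)" Y v m] XY False
        by (simp add: \<alpha>_eq \<beta>_eq transpose c.fibre_closed)
      moreover have "form_bracket A P \<alpha> (\<lambda>x. transpose_endo A N x (\<beta> x)) m v = 0"
        using form_bracket_outside[of X "\<lambda>x. N x (Y x)" v m] XY False
        by (simp add: \<alpha>_eq \<beta>_eq transpose c.fibre_closed)
      ultimately show ?thesis
        using False by (simp add: magri_morosi_def transpose_endo_def)
    qed
  qed
qed

text \<open>Symmetry of \<open>N\<close> for \<open>\<omega>\<close> says that the transpose of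
  \<open>N\<close> after the flat map is the flat map after \<open>N\<close>; inverting the flat map
  gives the claim.\<close>

lemma sharp_transpose:
  assumes "compatible_endomorphism A \<omega> \<omega>N N" "\<xi> \<in> fibre_dual A m"
  shows "N m (sharp A P m \<xi>) = sharp A P m (transpose_endo A N m \<xi>)"
proof -
  interpret c: compatible_endomorphism A \<omega> \<omega>N N by fact
  let ?v = "sharp A P m \<xi>"
  have v: "?v \<in> fibre A m" using assms(2) by (rule sharp_in_fibre)
  have "transpose_endo A N m \<xi> = flat A \<omega> m (N m ?v)"
    using v by (auto simp: transpose_endo_def flat_def c.form_symmetric[symmetric] two_form_sharp[OF assms(2)] c.fibre_closed)
  then show ?thesis by (simp add: sharp_flat v c.fibre_closed)
qed

end

subsection \<open>The Schouten bracket of an inverse bivector field\<close>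

text \<open>The replacement of \<open>(X, Y)\<close> by \<open>(Y, - X)\<close> sends the two
  entries of a block to \<open>(Y, - X)\<close> and \<open>(- X, - Y)\<close>; by the invariance of
  \<open>F\<close> this only permutes the block.\<close>

lemma sum_alternating_pairs_swap:
  fixes F :: "('m \<Rightarrow> 'v::real_vector) \<Rightarrow> ('m \<Rightarrow> 'v) \<Rightarrow> 'a::comm_monoid_add"
  assumes "\<And>X Y. (X, Y) \<in> set ps \<Longrightarrow> F (\<lambda>m. - X m) (\<lambda>m. - Y m) = F X Y"
  shows "(\<Sum>(X, Y)\<leftarrow>alternating_pairs ps. F Y (\<lambda>m. - X m)) = (\<Sum>(X, Y)\<leftarrow>alternating_pairs ps. F X Y)"
  using assms by (induction ps) (auto simp: alternating_pairs_def add_ac)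

context symplectic_pair
begin

text \<open>The last clause records that the pairs \<open>(U k, V k)\<close> come from a skew decomposition.  It does not
  follow from the expansion of \<open>P\<close>, since \<open>anchor_deriv\<close> is not tensorial in the sections under it.\<close>

definition bivector_frame :: "nat \<Rightarrow> (nat \<Rightarrow> 'm \<Rightarrow> 'v) \<Rightarrow> (nat \<Rightarrow> 'm \<Rightarrow> 'v) \<Rightarrow> bool" where
  "bivector_frame n U V \<longleftrightarrow>
     (\<forall>k<n. U k \<in> sections A \<and> V k \<in> sections A) \<and>
     (\<forall>m. \<forall>\<xi>\<in>fibre_dual A m. \<forall>\<eta>\<in>fibre_dual A m. P m \<xi> \<eta> = (\<Sum>k<n. \<xi> (U k m) * \<eta> (V k m))) \<and>
     (\<forall>X\<in>sections A. \<forall>Y\<in>sections A. \<forall>Z\<in>sections A. \<forall>m.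
        (\<Sum>k<n. anchor_deriv A Y (\<lambda>x. \<omega> x (Z x) (V k x)) m * \<omega> m (X m) (U k m))
          = - (\<Sum>k<n. anchor_deriv A Y (\<lambda>x. \<omega> x (Z x) (U k x)) m * \<omega> m (X m) (V k m)))"

lemma bivector_frame_of_decomposition:
  assumes "decomposes A P ps"
  shows "bivector_frame (length (alternating_pairs ps)) (\<lambda>k. fst (alternating_pairs ps ! k))
    (\<lambda>k. snd (alternating_pairs ps ! k))"
  unfolding bivector_frame_def
proof (intro conjI ballI allI impI)
  fix k assume "k < length (alternating_pairs ps)"
  from subsetD[OF alternating_pairs_sections[OF vb assms] nth_mem[OF this]]
  show "fst (alternating_pairs ps ! k) \<in> sections A" "snd (alternating_pairs ps ! k) \<in> sections A"
    by (auto simp: mem_Times_iff)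
next
  fix X Y Z m assume XYZ: "X \<in> sections A" "Y \<in> sections A" "Z \<in> sections A"
  define D where "D W = anchor_deriv A Y (\<lambda>x. \<omega> x (Z x) (W x)) m" for W
  define E where "E W = \<omega> m (X m) (W m)" for W
  have minus: "D (\<lambda>m. - W m) = - D W" "E (\<lambda>m. - W m) = - E W" if "W \<in> sections A" for W
  proof -
    have "(\<lambda>x. \<omega> x (Z x) (- W x)) = (\<lambda>x. - \<omega> x (Z x) (W x))"
      using XYZ that by (simp add: two_form_minus[OF vb two_form] section_in_fibre)
    then show "D (\<lambda>m. - W m) = - D W" "E (\<lambda>m. - W m) = - E W"
      using XYZ that
      by (simp_all add: D_def E_def two_form_minus[OF vb two_form] section_in_fibre anchor_deriv_minus
          two_form_smooth[OF vb two_form])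
  qed
  have ps: "set ps \<subseteq> sections A \<times> sections A"
    using assms by (simp add: decomposes_def)
  \<comment> \<open>Each section of a pair enters linearly, so negating both leaves the product
    fixed and the swap applies.\<close>
  have "(\<Sum>(U, V)\<leftarrow>alternating_pairs ps. D V * E U)
      = (\<Sum>(U, V)\<leftarrow>alternating_pairs ps. D (\<lambda>m. - U m) * E V)"
    using ps by (intro sum_alternating_pairs_swap[symmetric, where F = "\<lambda>U V. D V * E U"]) (auto simp: minus)
  also have "\<dots> = (\<Sum>(U, V)\<leftarrow>alternating_pairs ps. - (D U * E V))"
    using alternating_pairs_sections[OF vb assms]
    by (intro arg_cong[where f = sum_list] map_cong) (auto simp: minus)
  finally have "(\<Sum>(U, V)\<leftarrow>alternating_pairs ps. D V * E U) = (\<Sum>(U, V)\<leftarrow>alternating_pairs ps. - (D U * E V))" .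
  then have "(\<Sum>k<length (alternating_pairs ps). D (snd (alternating_pairs ps ! k)) * E (fst (alternating_pairs ps ! k)))
      = - (\<Sum>k<length (alternating_pairs ps). D (fst (alternating_pairs ps ! k)) * E (snd (alternating_pairs ps ! k)))"
    unfolding sum_list_pairs_nth by (simp add: sum_negf)
  then show "(\<Sum>k<length (alternating_pairs ps).
         anchor_deriv A Y (\<lambda>x. \<omega> x (Z x) (snd (alternating_pairs ps ! k) x)) m *
         \<omega> m (X m) (fst (alternating_pairs ps ! k) m)) =
      - (\<Sum>k<length (alternating_pairs ps).
         anchor_deriv A Y (\<lambda>x. \<omega> x (Z x) (fst (alternating_pairs ps ! k) x)) m *
         \<omega> m (X m) (snd (alternating_pairs ps ! k) m))"
    by (simp add: D_def E_def)
qed (rule decomposes_alternating_pairs[OF vb assms])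

lemma bivector_frameD:
  assumes "bivector_frame n U V"
  shows "k < n \<Longrightarrow> U k \<in> sections A" "k < n \<Longrightarrow> V k \<in> sections A"
  using assms by (auto simp: bivector_frame_def)

lemma bivector_frame_pairing:
  assumes F: "bivector_frame n U V" and u: "u \<in> fibre A m" and v: "v \<in> fibre A m"
  shows "(\<Sum>k<n. \<omega> m u (U k m) * \<omega> m v (V k m)) = \<omega> m v u"
proof -
  have "\<omega> m v u = (\<Sum>k<n. flat A \<omega> m u (U k m) * flat A \<omega> m v (V k m))"
    using F flat_dual[OF vb two_form] bivector_flat u v by (simp add: bivector_frame_def)
  then show ?thesis
    using bivector_frameD[OF F] by (simp add: flat_def section_in_fibre)
qed

text \<open>Expansion in the first factors instead of the second ones; the skew-symmetry of
  \<open>P\<close> costs the sign.\<close>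

lemma bivector_frame_expand:
  assumes F: "bivector_frame n U V" and v: "v \<in> fibre A m"
  shows "(\<Sum>k<n. \<omega> m v (V k m) *\<^sub>R U k m) = - v"
proof (rule nondegenerate_eqI)
  note UV = bivector_frameD[OF F]
  show "(\<Sum>k<n. \<omega> m v (V k m) *\<^sub>R U k m) \<in> fibre A m" "- v \<in> fibre A m"
    using UV v by (auto simp: section_in_fibre
        intro!: subspace_sum subspace_scale subspace_neg subspace_fibre[OF vb])
  fix w assume w: "w \<in> fibre A m"
  have "linear_on_set (fibre A m) (\<omega> m w)"
    using two_form w by (auto simp: two_forms_def)
  then have "\<omega> m w (\<Sum>k<n. \<omega> m v (V k m) *\<^sub>R U k m) = (\<Sum>k<n. \<omega> m v (V k m) * \<omega> m w (U k m))"
    using UV by (subst linear_on_set_sum[OF subspace_fibre[OF vb]]) (auto simp: section_in_fibre)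
  also have "\<dots> = \<omega> m v w"
    using bivector_frame_pairing[OF F w v] by (simp add: mult.commute)
  finally show "\<omega> m (\<Sum>k<n. \<omega> m v (V k m) *\<^sub>R U k m) w = \<omega> m (- v) w"
    using two_form_skew[OF vb two_form w \<open>(\<Sum>k<n. \<omega> m v (V k m) *\<^sub>R U k m) \<in> fibre A m\<close>]
    by (simp add: two_form_minus[OF vb two_form v w])
qed

text \<open>Equals \<open>\<omega> (\<nabla>\<^sub>Y Z) X\<close> for the connection
  \<open>\<nabla>\<close> that differentiates the coefficients of \<open>Z\<close> in the expansion
  \<open>Z = - (\<Sum>k<n. \<omega> Z (V k) *\<^sub>R U k)\<close>.\<close>

definition frame_term :: "nat \<Rightarrow> (nat \<Rightarrow> 'm \<Rightarrow> 'v) \<Rightarrow> (nat \<Rightarrow> 'm \<Rightarrow> 'v) \<Rightarrow>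
    ('m \<Rightarrow> 'v) \<Rightarrow> ('m \<Rightarrow> 'v) \<Rightarrow> ('m \<Rightarrow> 'v) \<Rightarrow> 'm \<Rightarrow> real" where
  "frame_term n U V Y Z X m = (\<Sum>k<n. anchor_deriv A Y (\<lambda>x. \<omega> x (Z x) (V k x)) m * \<omega> m (X m) (U k m))"

text \<open>The connection behind \<open>frame_term\<close> preserves \<open>\<omega>\<close>; this
  is the product rule applied to \<open>bivector_frame_pairing\<close>.\<close>

lemma frame_term_diff:
  assumes F: "bivector_frame n U V" and X: "X \<in> sections A" and Y: "Y \<in> sections A" and Z: "Z \<in> sections A"
  shows "frame_term n U V Y Z X m - frame_term n U V Y X Z m = anchor_deriv A Y (\<lambda>x. \<omega> x (Z x) (X x)) m"
proof -
  note UV = bivector_frameD[OF F]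
  note smooth = two_form_smooth[OF vb two_form]
  have "(\<lambda>x. - \<omega> x (Z x) (X x)) = (\<lambda>x. \<Sum>k<n. \<omega> x (Z x) (U k x) * \<omega> x (X x) (V k x))"
    using two_form_skew[OF vb two_form section_in_fibre[OF Z] section_in_fibre[OF X]] X Z
    by (simp add: bivector_frame_pairing[OF F] section_in_fibre)
  then have "- anchor_deriv A Y (\<lambda>x. \<omega> x (Z x) (X x)) m
      = anchor_deriv A Y (\<lambda>x. \<Sum>k<n. \<omega> x (Z x) (U k x) * \<omega> x (X x) (V k x)) m"
    using anchor_deriv_minus[OF Y smooth[OF Z X], of m] by simp
  also have "\<dots> = (\<Sum>k<n. anchor_deriv A Y (\<lambda>x. \<omega> x (Z x) (U k x)) m * \<omega> m (X m) (V k m))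
      + (\<Sum>k<n. \<omega> m (Z m) (U k m) * anchor_deriv A Y (\<lambda>x. \<omega> x (X x) (V k x)) m)"
    using X Y Z UV by (subst anchor_deriv_sum)
      (auto simp: anchor_deriv_mult smooth sum.distrib intro: smooth_funs_mult[OF vb])
  \<comment> \<open>Here the derivative falls on the pairing with \<open>U k\<close>; the last
    clause of \<open>bivector_frame\<close> exchanges the roles of \<open>U\<close> and
    \<open>V\<close>.\<close>
  also have "(\<Sum>k<n. anchor_deriv A Y (\<lambda>x. \<omega> x (Z x) (U k x)) m * \<omega> m (X m) (V k m))
      = - frame_term n U V Y Z X m"
    using F X Y Z by (simp add: bivector_frame_def frame_term_def)
  finally show ?thesis by (simp add: frame_term_def mult.commute)
qed

text \<open>The right-hand side is \<open>\<omega>\<close> of \<open>X\<close> with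
  \<open>[Y,Z] + \<nabla>\<^sub>Z Y - \<nabla>'\<^sub>Y Z\<close>, a torsion up to sign. It results
  from expanding \<open>Y\<close> and \<open>Z\<close> in their frames and applying the Leibniz rule
  twice.\<close>

lemma frame_bracket_sum:
  assumes F: "bivector_frame n U V" and F': "bivector_frame n' U' V'"
    and X: "X \<in> sections A" and Y: "Y \<in> sections A" and Z: "Z \<in> sections A"
  shows "(\<Sum>k<n. \<Sum>l<n'. \<omega> m (X m) (bracket A (U k) (U' l) m) * (\<omega> m (Y m) (V k m) * \<omega> m (Z m) (V' l m)))
    = \<omega> m (X m) (bracket A Y Z m) - frame_term n U V Z Y X m + frame_term n' U' V' Y Z X m"
proof -
  note UV = bivector_frameD[OF F] and UV' = bivector_frameD[OF F']
  note smooth = two_form_smooth[OF vb two_form]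
  define b where "b k x = \<omega> x (Y x) (V k x)" for k x
  define c where "c l x = \<omega> x (Z x) (V' l x)" for l x
  have b: "b k \<in> smooth_funs A" if "k < n" for k
    using smooth[OF Y UV(2)[OF that]] by (simp add: b_def[abs_def])
  have c: "c l \<in> smooth_funs A" if "l < n'" for l
    using smooth[OF Z UV'(2)[OF that]] by (simp add: c_def[abs_def])
  have lin: "linear_on_set (fibre A m) (\<omega> m (X m))"
    using two_form section_in_fibre[OF X] by (auto simp: two_forms_def)
  have lin_sum: "\<omega> m (X m) (\<Sum>k<j. f k *\<^sub>R u k + g k *\<^sub>R v k)
      = (\<Sum>k<j. f k * \<omega> m (X m) (u k) + g k * \<omega> m (X m) (v k))"
    if "\<And>k. k < j \<Longrightarrow> u k \<in> fibre A m" "\<And>k. k < j \<Longrightarrow> v k \<in> fibre A m" for f g and u v :: "nat \<Rightarrow> 'v" and j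
  proof -
    have "(\<Sum>k<j. f k *\<^sub>R u k) \<in> fibre A m" "(\<Sum>k<j. g k *\<^sub>R v k) \<in> fibre A m"
      using that by (auto intro!: subspace_sum subspace_scale subspace_fibre[OF vb])
    moreover have "\<omega> m (X m) (\<Sum>k<j. f k *\<^sub>R u k) = (\<Sum>k<j. f k * \<omega> m (X m) (u k))"
      "\<omega> m (X m) (\<Sum>k<j. g k *\<^sub>R v k) = (\<Sum>k<j. g k * \<omega> m (X m) (v k))"
      using that linear_on_set_sum[OF subspace_fibre[OF vb] lin, of "{..<j}"] by simp_all
    ultimately show ?thesis
      using X by (simp add: sum.distrib two_form_add[OF vb two_form] section_in_fibre)
  qed
  have Y_eq: "(\<lambda>x. \<Sum>k<n. b k x *\<^sub>R U k x) = (\<lambda>x. - Y x)"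
    using bivector_frame_expand[OF F] Y by (simp add: b_def section_in_fibre)
  have Z_eq: "(\<lambda>x. \<Sum>l<n'. c l x *\<^sub>R U' l x) = (\<lambda>x. - Z x)"
    using bivector_frame_expand[OF F'] Z by (simp add: c_def section_in_fibre)
  have minus: "bracket A W (\<lambda>x. - T x) m = - bracket A W T m" if "W \<in> sections A" "T \<in> sections A" for W T
    using bracket_add_right[OF that sections_minus[OF vb that(2)], of m] bracket_zero_right[OF that(1), of m]
    by (simp add: eq_neg_iff_add_eq_0 add.commute)
  have inner: "\<omega> m (X m) (bracket A Y (U' l) m)
      = (\<Sum>k<n. anchor_deriv A (U' l) (b k) m * \<omega> m (X m) (U k m) - b k m * \<omega> m (X m) (bracket A (U k) (U' l) m))"
    if l: "l < n'" for l
  proof -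
    have "bracket A Y (U' l) m = bracket A (U' l) (\<lambda>x. \<Sum>k<n. b k x *\<^sub>R U k x) m"
      using bracket_skew[OF UV'(1)[OF l] Y] minus[OF UV'(1)[OF l] Y] by (simp add: Y_eq)
    also have "\<dots> = (\<Sum>k<n. b k m *\<^sub>R bracket A (U' l) (U k) m + anchor_deriv A (U' l) (b k) m *\<^sub>R U k m)"
      using UV b UV'(1)[OF l] by (intro bracket_sum_right) auto
    finally have "\<omega> m (X m) (bracket A Y (U' l) m) = (\<Sum>k<n. b k m * \<omega> m (X m) (bracket A (U' l) (U k) m)
        + anchor_deriv A (U' l) (b k) m * \<omega> m (X m) (U k m))"
      using UV UV'(1)[OF l] by (simp add: lin_sum bracket_in_fibre section_in_fibre)
    also have "\<dots> = (\<Sum>k<n. anchor_deriv A (U' l) (b k) m * \<omega> m (X m) (U k m)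
        - b k m * \<omega> m (X m) (bracket A (U k) (U' l) m))"
    proof (intro sum.cong refl)
      fix k assume "k \<in> {..<n}"
      then have "bracket A (U' l) (U k) m = - bracket A (U k) (U' l) m"
        using bracket_skew[OF UV(1) UV'(1)[OF l]] by simp
      then show "b k m * \<omega> m (X m) (bracket A (U' l) (U k) m) + anchor_deriv A (U' l) (b k) m * \<omega> m (X m) (U k m)
          = anchor_deriv A (U' l) (b k) m * \<omega> m (X m) (U k m) - b k m * \<omega> m (X m) (bracket A (U k) (U' l) m)"
        using \<open>k \<in> {..<n}\<close> UV UV'(1)[OF l] X
        by (simp add: two_form_minus[OF vb two_form] bracket_in_fibre section_in_fibre)
    qed
    finally show ?thesis .
  qed
  \<comment> \<open>Linearity of the anchor reassembles the frame vectors \<open>U' l\<close> into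
    \<open>- Z\<close>.\<close>
  have anchor_Z: "(\<Sum>l<n'. c l m * anchor_deriv A (U' l) f m) = - anchor_deriv A Z f m" if f: "f \<in> smooth_funs A" for f
  proof -
    have "(\<Sum>l<n'. c l m * anchor A m (U' l m) f) = anchor A m (\<Sum>l<n'. c l m *\<^sub>R U' l m) f"
      using UV' by (subst linear_on_set_sum[OF subspace_fibre[OF vb] anchor_linear[OF f]])
        (auto simp: section_in_fibre)
    also have "\<dots> = - anchor A m (Z m) f"
      using fun_cong[OF Z_eq, of m] linear_on_set_minus[OF anchor_linear[OF f] section_in_fibre[OF Z]] by simp
    finally show ?thesis by (simp add: anchor_deriv_def)
  qed
  have "- \<omega> m (X m) (bracket A Y Z m) = \<omega> m (X m) (bracket A Y (\<lambda>x. \<Sum>l<n'. c l x *\<^sub>R U' l x) m)"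
    using X Y Z by (simp add: Z_eq minus two_form_minus[OF vb two_form] bracket_in_fibre section_in_fibre)
  also have "\<dots> = (\<Sum>l<n'. c l m * \<omega> m (X m) (bracket A Y (U' l) m) + anchor_deriv A Y (c l) m * \<omega> m (X m) (U' l m))"
    using UV' c Y by (subst bracket_sum_right) (auto simp: lin_sum bracket_in_fibre section_in_fibre)
  also have "\<dots> = (\<Sum>l<n'. c l m * \<omega> m (X m) (bracket A Y (U' l) m)) + frame_term n' U' V' Y Z X m"
    by (simp add: sum.distrib frame_term_def c_def[abs_def])
  also have "(\<Sum>l<n'. c l m * \<omega> m (X m) (bracket A Y (U' l) m))
      = (\<Sum>l<n'. \<Sum>k<n. c l m * (anchor_deriv A (U' l) (b k) m * \<omega> m (X m) (U k m)))
        - (\<Sum>l<n'. \<Sum>k<n. c l m * (b k m * \<omega> m (X m) (bracket A (U k) (U' l) m)))"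
    by (simp add: inner sum_distrib_left sum_subtractf right_diff_distrib)
  also have "(\<Sum>l<n'. \<Sum>k<n. c l m * (anchor_deriv A (U' l) (b k) m * \<omega> m (X m) (U k m)))
      = (\<Sum>k<n. (\<Sum>l<n'. c l m * anchor_deriv A (U' l) (b k) m) * \<omega> m (X m) (U k m))"
    by (subst sum.swap) (simp add: sum_distrib_right mult.assoc)
  also have "\<dots> = - frame_term n U V Z Y X m"
    using b by (simp add: anchor_Z frame_term_def sum_negf b_def[abs_def])
  also have "(\<Sum>l<n'. \<Sum>k<n. c l m * (b k m * \<omega> m (X m) (bracket A (U k) (U' l) m)))
      = (\<Sum>k<n. \<Sum>l<n'. \<omega> m (X m) (bracket A (U k) (U' l) m) * (\<omega> m (Y m) (V k m) * \<omega> m (Z m) (V' l m)))"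
    by (subst sum.swap) (simp add: b_def c_def mult_ac)
  finally show ?thesis by simp
qed

text \<open>Of the six terms of \<open>wedge3\<close>, the brackets pair up by skew-symmetry and the
  connection terms by \<open>frame_term_diff\<close>. Each of the two frames yields the derivative
  terms of the differential once, hence the factor 2.\<close>

lemma schouten_frames:
  assumes F: "bivector_frame n U V" and F': "bivector_frame n' U' V'"
    and X: "X \<in> sections A" and Y: "Y \<in> sections A" and Z: "Z \<in> sections A"
  shows "(\<Sum>k<n. \<Sum>l<n'. wedge3 (bracket A (U k) (U' l) m) (V k m) (V' l m)
      (flat A \<omega> m (X m)) (flat A \<omega> m (Y m)) (flat A \<omega> m (Z m))) = 2 * d_two_form A \<omega> X Y Z m"
proof -
  let ?K = "\<lambda>X Y Z. \<Sum>k<n. \<Sum>l<n'. \<omega> m (X m) (bracket A (U k) (U' l) m) * (\<omega> m (Y m) (V k m) * \<omega> m (Z m) (V' l m))"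
  note UV = bivector_frameD[OF F] and UV' = bivector_frameD[OF F']
  have "(\<Sum>k<n. \<Sum>l<n'. wedge3 (bracket A (U k) (U' l) m) (V k m) (V' l m)
      (flat A \<omega> m (X m)) (flat A \<omega> m (Y m)) (flat A \<omega> m (Z m)))
    = (\<Sum>k<n. \<Sum>l<n'.
        \<omega> m (X m) (bracket A (U k) (U' l) m) * (\<omega> m (Y m) (V k m) * \<omega> m (Z m) (V' l m))
      - \<omega> m (X m) (bracket A (U k) (U' l) m) * (\<omega> m (Z m) (V k m) * \<omega> m (Y m) (V' l m))
      + \<omega> m (Y m) (bracket A (U k) (U' l) m) * (\<omega> m (Z m) (V k m) * \<omega> m (X m) (V' l m))
      - \<omega> m (Y m) (bracket A (U k) (U' l) m) * (\<omega> m (X m) (V k m) * \<omega> m (Z m) (V' l m))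
      + \<omega> m (Z m) (bracket A (U k) (U' l) m) * (\<omega> m (X m) (V k m) * \<omega> m (Y m) (V' l m))
      - \<omega> m (Z m) (bracket A (U k) (U' l) m) * (\<omega> m (Y m) (V k m) * \<omega> m (X m) (V' l m)))"
    using UV UV' by (intro sum.cong refl) (simp add: wedge3_def flat_def section_in_fibre bracket_in_fibre algebra_simps)
  also have "\<dots> = ?K X Y Z - ?K X Z Y + ?K Y Z X - ?K Y X Z + ?K Z X Y - ?K Z Y X"
    by (simp add: sum.distrib sum_subtractf)
  also have "\<dots> = 2 * d_two_form A \<omega> X Y Z m"
  proof -
    have flip: "\<omega> m (S m) (bracket A T W m) = - \<omega> m (bracket A T W m) (S m)"
      "bracket A W T m = - bracket A T W m"
      "\<omega> m (S m) (- bracket A T W m) = \<omega> m (bracket A T W m) (S m)"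
      if "S \<in> sections A" "T \<in> sections A" "W \<in> sections A" for S T W
      using that two_form_skew[OF vb two_form bracket_in_fibre section_in_fibre] bracket_skew[of T W]
      by (simp_all add: two_form_minus[OF vb two_form] bracket_in_fibre section_in_fibre)
    note D = frame_term_diff[OF F, of _ _ _ m] frame_term_diff[OF F', of _ _ _ m]
    show ?thesis
      unfolding frame_bracket_sum[OF F F' X Y Z] frame_bracket_sum[OF F F' X Z Y]
        frame_bracket_sum[OF F F' Y Z X] frame_bracket_sum[OF F F' Y X Z]
        frame_bracket_sum[OF F F' Z X Y] frame_bracket_sum[OF F F' Z Y X]
        d_two_form_alt[OF two_form X Y Z]
        flip(2)[OF X Y Z] flip(2)[OF X Z X] flip(2)[OF X X Y]
      using D[OF X Y Z] D[OF Y Z X] D[OF Z X Y]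
      by (simp add: flip(1)[OF X Y Z] flip(3)[OF X Y Z] flip(1)[OF Y Z X] flip(3)[OF Y Z X]
          flip(1)[OF Z X Y] flip(3)[OF Z X Y])
  qed
  finally show ?thesis .
qed

lemma schouten_zero:
  assumes closed: "\<And>X Y Z m. X \<in> sections A \<Longrightarrow> Y \<in> sections A \<Longrightarrow> Z \<in> sections A \<Longrightarrow> d_two_form A \<omega> X Y Z m = 0"
  shows "schouten A P P = (\<lambda>m \<xi> \<eta> \<zeta>. 0)"
proof -
  have zero: "(\<Sum>(X, Y)\<leftarrow>ps. \<Sum>(Z, W)\<leftarrow>qs.
                wedge3 (bracket A X Z m) (Y m) (W m) \<xi> \<eta> \<zeta>
                - wedge3 (bracket A X W m) (Y m) (Z m) \<xi> \<eta> \<zeta>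
                - wedge3 (bracket A Y Z m) (X m) (W m) \<xi> \<eta> \<zeta>
                + wedge3 (bracket A Y W m) (X m) (Z m) \<xi> \<eta> \<zeta>) = 0"
    if ps: "decomposes A P ps" and qs: "decomposes A P qs"
      and dual: "\<xi> \<in> fibre_dual A m" "\<eta> \<in> fibre_dual A m" "\<zeta> \<in> fibre_dual A m" for ps qs m \<xi> \<eta> \<zeta>
  proof -
    let ?us = "alternating_pairs ps" and ?vs = "alternating_pairs qs"
    define F where "F X Y Z W = wedge3 (bracket A X Z m) (Y m) (W m) \<xi> \<eta> \<zeta>" for X Y Z W
    define G where "G X Y = (\<Sum>(Z, W)\<leftarrow>?vs. F X Y Z W)" for X Y
    note dual_minus = linear_on_set_minus[OF fibre_dual_linear]
    have minus: "F X (\<lambda>m. - Y m) Z W = - F X Y Z W" "F X Y Z (\<lambda>m. - W m) = - F X Y Z W"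
      if "Y \<in> sections A" "W \<in> sections A" for X Y Z W
      using that dual by (simp_all add: F_def wedge3_def dual_minus section_in_fibre algebra_simps)
    have sections: "set ps \<subseteq> sections A \<times> sections A" "set qs \<subseteq> sections A \<times> sections A"
      using ps qs by (simp_all add: decomposes_def)
    have G_eq: "G X Y = (\<Sum>(Z, W)\<leftarrow>qs. F X Y Z W + F X Y W (\<lambda>m. - Z m))" for X Y
      unfolding G_def by (rule sum_list_alternating_pairs[symmetric])
    \<comment> \<open>The signs of the four Schouten terms are those of
      \<open>alternating_pairs\<close>, since the negated section always lands in an unbracketed
      slot, where \<open>wedge3\<close> is linear.\<close>
    have "(\<Sum>(X, Y)\<leftarrow>ps. \<Sum>(Z, W)\<leftarrow>qs. F X Y Z W - F X Y W Z - F Y X Z W + F Y X W Z)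
        = (\<Sum>(X, Y)\<leftarrow>ps. G X Y + G Y (\<lambda>m. - X m))"
    proof (intro arg_cong[where f = sum_list] map_cong refl)
      fix p assume "p \<in> set ps"
      then obtain X Y where p: "p = (X, Y)" "X \<in> sections A" "Y \<in> sections A"
        using sections by auto
      have "G X Y + G Y (\<lambda>m. - X m) = (\<Sum>(Z, W)\<leftarrow>qs. (F X Y Z W + F X Y W (\<lambda>m. - Z m))
          + (F Y (\<lambda>m. - X m) Z W + F Y (\<lambda>m. - X m) W (\<lambda>m. - Z m)))"
        unfolding G_eq by (induction qs) (auto simp: add_ac)
      also have "\<dots> = (\<Sum>(Z, W)\<leftarrow>qs. F X Y Z W - F X Y W Z - F Y X Z W + F Y X W Z)"
      proof (intro arg_cong[where f = sum_list] map_cong refl)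
        fix q assume "q \<in> set qs"
        then obtain Z W where q: "q = (Z, W)" "Z \<in> sections A" "W \<in> sections A"
          using sections by auto
        show "(case q of (Z, W) \<Rightarrow> (F X Y Z W + F X Y W (\<lambda>m. - Z m)) + (F Y (\<lambda>m. - X m) Z W + F Y (\<lambda>m. - X m) W (\<lambda>m. - Z m)))
          = (case q of (Z, W) \<Rightarrow> F X Y Z W - F X Y W Z - F Y X Z W + F Y X W Z)"
          using p q minus(1)[of X W Y Z] minus(1)[of X W Y "\<lambda>m. - Z m"]
          by (simp add: q(1) minus sections_minus[OF vb])
      qed
      finally show "(case p of (X, Y) \<Rightarrow> \<Sum>(Z, W)\<leftarrow>qs. F X Y Z W - F X Y W Z - F Y X Z W + F Y X W Z)
          = (case p of (X, Y) \<Rightarrow> G X Y + G Y (\<lambda>m. - X m))"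
        by (simp add: p)
    qed
    also have "\<dots> = (\<Sum>(X, Y)\<leftarrow>?us. G X Y)"
      by (rule sum_list_alternating_pairs)
    also have "\<dots> = (\<Sum>k<length ?us. \<Sum>l<length ?vs. F (fst (?us ! k)) (snd (?us ! k)) (fst (?vs ! l)) (snd (?vs ! l)))"
      unfolding G_def sum_list_pairs_nth ..
    also have "\<dots> = 0"
    proof -
      \<comment> \<open>The covectors are written as flats of values of global sections, as the
        differential takes sections.\<close>
      obtain X where X: "X \<in> sections A" "X m = sharp A P m \<xi>" using section_through[OF sharp_in_fibre[OF dual(1)]] .
      obtain Y where Y: "Y \<in> sections A" "Y m = sharp A P m \<eta>" using section_through[OF sharp_in_fibre[OF dual(2)]] .
      obtain Z where Z: "Z \<in> sections A" "Z m = sharp A P m \<zeta>" using section_through[OF sharp_in_fibre[OF dual(3)]] .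
      show ?thesis
        using schouten_frames[OF bivector_frame_of_decomposition[OF ps] bivector_frame_of_decomposition[OF qs]
            X(1) Y(1) Z(1), of m] closed[OF X(1) Y(1) Z(1)]
        by (simp add: F_def X(2) Y(2) Z(2) flat_sharp dual)
    qed
    finally show ?thesis by (simp add: F_def)
  qed
  \<comment> \<open>One decomposition must exist: otherwise the condition under \<open>THE\<close>
    would be vacuous and would not single out a tensor.\<close>
  obtain ps where "decomposes A P ps" using bivector by (auto simp: bivector_fields_def)
  then show ?thesis
    unfolding schouten_def
    by (intro the_equality) (simp_all add: zero fun_eq_iff)
qed

lemma PN_structure_of_closed:
  assumes compat: "compatible_endomorphism A \<omega> \<omega>N N"
    and closed: "\<And>X Y Z m. X \<in> sections A \<Longrightarrow> Y \<in> sections A \<Longrightarrow> Z \<in> sections A \<Longrightarrow> d_two_form A \<omega> X Y Z m = 0"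
      "\<And>X Y Z m. X \<in> sections A \<Longrightarrow> Y \<in> sections A \<Longrightarrow> Z \<in> sections A \<Longrightarrow> d_two_form A \<omega>N X Y Z m = 0"
    and sq: "\<And>m v. v \<in> fibre A m \<Longrightarrow> N m (N m v) = e *\<^sub>R v"
  shows "PN_structure A P N"
  unfolding PN_structure_def
proof (intro conjI ballI allI)
  show "schouten A P P = (\<lambda>m \<xi> \<eta> \<zeta>. 0)"
    by (rule schouten_zero) (rule closed(1))
  show "torsion A N X Y = (\<lambda>m. 0)" if "X \<in> sections A" "Y \<in> sections A" for X Y
    using compat closed sq that by (rule torsion_zero)
  show "magri_morosi A P N \<alpha> \<beta> = (\<lambda>m v. 0)" if "\<alpha> \<in> one_forms A" "\<beta> \<in> one_forms A" for \<alpha> \<beta>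
    using compat closed that by (rule magri_morosi_zero)
qed (rule bivector compatible_endomorphism.N[OF compat] sharp_transpose[OF compat]; assumption?)+

end

subsection \<open>Hypersymplectic structures with \<open>\<epsilon>\<^sub>1\<epsilon>\<^sub>2\<epsilon>\<^sub>3 = 1\<close>\<close>

lemma index3 [simp]: "(i::3) + 1 + 1 = i - 1" "(i::3) - 1 - 1 = i + 1"
  using exhaust_3[of i] by auto

text \<open>Brings the numerals that arise from \<open>i - 1\<close> and \<open>i + 1\<close> back
  to the representatives 1, 2, 3.\<close>

lemma index3_numerals [simp]: "(0::3) = 3" "(4::3) = 1"
  by simp_all

locale commuting_hypersymplectic = skew_algebroid A
  for A :: "('m::{t2_space,second_countable_topology}, 'e::real_normed_vector, 'v::real_vector,
               'f::real_normed_vector) lie_algebroid" +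
  fixes \<omega> :: "3 \<Rightarrow> 'm \<Rightarrow> 'v \<Rightarrow> 'v \<Rightarrow> real"
    and \<pi> :: "3 \<Rightarrow> 'm \<Rightarrow> ('v \<Rightarrow> real) \<Rightarrow> ('v \<Rightarrow> real) \<Rightarrow> real"
    and \<epsilon> :: "3 \<Rightarrow> real"
  assumes hyper: "hypersymplectic A \<omega> \<pi> \<epsilon>" and sign_product: "\<epsilon> 1 * \<epsilon> 2 * \<epsilon> 3 = 1"
begin

abbreviation N :: "3 \<Rightarrow> 'm \<Rightarrow> 'v \<Rightarrow> 'v" where "N \<equiv> transition A \<omega> \<pi>"

lemma form: "\<omega> i \<in> two_forms A"
  and closed: "X \<in> sections A \<Longrightarrow> Y \<in> sections A \<Longrightarrow> Z \<in> sections A \<Longrightarrow> d_two_form A (\<omega> i) X Y Z m = 0"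
  using hyper by (auto simp: hypersymplectic_def symplectic_def)

lemma pair: "symplectic_pair A (\<omega> i) (\<pi> i)"
proof unfold_locales
  fix v m assume "v \<in> fibre A m" "\<And>w. w \<in> fibre A m \<Longrightarrow> \<omega> i m v w = 0"
  moreover have "\<forall>m. \<forall>v\<in>fibre A m. (\<forall>w\<in>fibre A m. \<omega> i m v w = 0) \<longrightarrow> v = 0"
    using hyper by (simp add: hypersymplectic_def symplectic_def)
  ultimately show "v = 0" by blast
qed (use hyper vb form in \<open>auto simp: hypersymplectic_def\<close>)

lemma eqI:
  assumes "u \<in> fibre A m" "v \<in> fibre A m" "\<And>w. w \<in> fibre A m \<Longrightarrow> \<omega> i m u w = \<omega> i m v w"
  shows "u = v"
proof -
  interpret symplectic_pair A "\<omega> i" "\<pi> i" by (rule pair)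
  show ?thesis using assms by (rule nondegenerate_eqI)
qed

lemma sign_cases: "\<epsilon> i = 1 \<or> \<epsilon> i = -1"
  using hyper by (auto simp: hypersymplectic_def)

lemma sign_square [simp]: "\<epsilon> i * \<epsilon> i = 1" "\<epsilon> i * (\<epsilon> i * x) = x"
  using sign_cases[of i] by auto

lemma sign_prod: "\<epsilon> i * \<epsilon> (i + 1) = \<epsilon> (i - 1)"
proof -
  have "\<epsilon> 1 * \<epsilon> 2 = \<epsilon> 3" "\<epsilon> 2 * \<epsilon> 3 = \<epsilon> 1" "\<epsilon> 3 * \<epsilon> 1 = \<epsilon> 2"
    using sign_product sign_cases[of 1] sign_cases[of 2] sign_cases[of 3] by auto
  then show ?thesis using exhaust_3[of i] by auto
qed

section \<open>Algebra of the transition tensors\<close>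

lemma N_in_fibre: "u \<in> fibre A m \<Longrightarrow> N i m u \<in> fibre A m"
  and form_N: "u \<in> fibre A m \<Longrightarrow> v \<in> fibre A m \<Longrightarrow> \<omega> (i - 1) m (N i m u) v = \<omega> (i + 1) m u v"
  and N_section: "X \<in> sections A \<Longrightarrow> (\<lambda>m. N i m (X m)) \<in> sections A"
proof -
  interpret symplectic_pair A "\<omega> (i - 1)" "\<pi> (i - 1)" by (rule pair)
  show "N i m u \<in> fibre A m" if "u \<in> fibre A m"
    using sharp_in_fibre[OF flat_dual[OF vb form that]] by (simp add: transition_def)
  show "\<omega> (i - 1) m (N i m u) v = \<omega> (i + 1) m u v" if "u \<in> fibre A m" "v \<in> fibre A m"
    using two_form_sharp[OF flat_dual[OF vb form that(1)] that(2)] that(2) by (simp add: transition_def flat_def)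
  show "(\<lambda>m. N i m (X m)) \<in> sections A" if "X \<in> sections A"
    using sharp_section[OF flat_one_form[OF vb form that]] by (simp add: transition_def)
qed

lemma N_square: "u \<in> fibre A m \<Longrightarrow> N i m (N i m u) = \<epsilon> i *\<^sub>R u"
  using hyper by (simp add: hypersymplectic_def)

lemmas fibre_add = subspace_add[OF subspace_fibre[OF vb]]
  and fibre_scaleR = subspace_scale[OF subspace_fibre[OF vb]]

lemma N_linear: "linear_on_set (fibre A m) (N i m)"
  unfolding linear_on_set_def
proof (intro conjI ballI allI)
  fix u v assume "u \<in> fibre A m" "v \<in> fibre A m"
  then show "N i m (u + v) = N i m u + N i m v"
    by (intro eqI[of _ m _ "i - 1"])
       (simp_all add: N_in_fibre fibre_add form_N two_form_add[OF vb form])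
next
  fix c u assume "u \<in> fibre A m"
  then show "N i m (c *\<^sub>R u) = c *\<^sub>R N i m u"
    by (intro eqI[of _ m _ "i - 1"])
       (simp_all add: N_in_fibre fibre_scaleR form_N two_form_scaleR[OF vb form])
qed

lemma N_scaleR: "u \<in> fibre A m \<Longrightarrow> N i m (c *\<^sub>R u) = c *\<^sub>R N i m u"
  using N_linear by (simp add: linear_on_set_def)

lemma N_endomorphism: "N i \<in> endomorphisms A"
  by (auto simp: endomorphisms_def N_linear N_in_fibre N_section)

lemma form_N': "u \<in> fibre A m \<Longrightarrow> v \<in> fibre A m \<Longrightarrow> \<omega> (i + 1) m (N i m u) v = \<epsilon> i * \<omega> (i - 1) m u v"
  using form_N[OF N_in_fibre[of u m i], of v i] by (simp add: N_square two_form_scaleR[OF vb form])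

text \<open>Peeling the factors off by \<open>form_N\<close> leads from
  \<open>\<omega> (i + 1)\<close> through \<open>\<omega> i\<close> and
  \<open>\<omega> (i - 1)\<close> back to \<open>\<omega> (i + 1)\<close>.\<close>

lemma N_cyclic:
  assumes u: "u \<in> fibre A m"
  shows "N (i - 1) m (N (i + 1) m (N i m u)) = u"
proof (rule eqI[of _ m _ "i + 1"])
  fix w assume w: "w \<in> fibre A m"
  have "\<omega> (i + 1) m (N (i - 1) m (N (i + 1) m (N i m u))) w = \<omega> i m (N (i + 1) m (N i m u)) w"
    using form_N[of "N (i + 1) m (N i m u)" m w "i - 1"] u w by (simp add: N_in_fibre)
  also have "\<dots> = \<omega> (i + 1) m u w"
    using form_N[of "N i m u" m w "i + 1"] u w by (simp add: N_in_fibre form_N)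
  finally show "\<omega> (i + 1) m (N (i - 1) m (N (i + 1) m (N i m u))) w = \<omega> (i + 1) m u w" .
qed (simp_all add: u N_in_fibre)

lemma N_mult: "u \<in> fibre A m \<Longrightarrow> N (i + 1) m (N i m u) = \<epsilon> (i - 1) *\<^sub>R N (i - 1) m u"
  using N_square[of "N (i + 1) m (N i m u)" m "i - 1"]
    arg_cong[OF N_cyclic[of u m i], of "\<lambda>v. \<epsilon> (i - 1) *\<^sub>R N (i - 1) m v"]
  by (simp add: N_in_fibre)

text \<open>Applying \<open>N_cyclic\<close> to the reversed product nests three squares, which
  collapse to the product of the three signs. The hypothesis on this product enters here.\<close>

lemma N_cyclic':
  assumes u: "u \<in> fibre A m"
  shows "N i m (N (i + 1) m (N (i - 1) m u)) = u"
proof -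
  let ?v = "N i m (N (i + 1) m (N (i - 1) m u))"
  have "?v = N (i - 1) m (N (i + 1) m (N i m ?v))"
    using u by (simp add: N_cyclic N_in_fibre)
  also have "\<dots> = (\<epsilon> i * \<epsilon> (i + 1) * \<epsilon> (i - 1)) *\<^sub>R u"
    using u by (simp add: N_square N_scaleR N_in_fibre fibre_scaleR mult_ac)
  finally show ?thesis by (simp add: sign_prod)
qed

lemma N_mult': "u \<in> fibre A m \<Longrightarrow> N i m (N (i + 1) m u) = \<epsilon> (i - 1) *\<^sub>R N (i - 1) m u"
  using N_cyclic'[of "N (i - 1) m u" m i]
  by (simp add: N_square N_scaleR N_in_fibre fibre_scaleR)
     (metis N_in_fibre fibre_scaleR scaleR_one scaleR_scaleR sign_square(1))

lemma N_commute: "u \<in> fibre A m \<Longrightarrow> N i m (N (i + 1) m u) = N (i + 1) m (N i m u)"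
  by (simp add: N_mult N_mult')

text \<open>Every \<open>N i\<close> is symmetric for \<open>\<omega> i\<close> too, because \<open>\<omega> i\<close> is \<open>\<omega> (i + 1)\<close> composed with
  \<open>N (i - 1)\<close>, which commutes with \<open>N i\<close>.\<close>

lemma form_N_diagonal_skew:
  assumes u: "u \<in> fibre A m" and v: "v \<in> fibre A m"
  shows "\<omega> i m (N i m v) u = - \<omega> i m (N i m u) v"
proof -
  have sym: "\<omega> (i + 1) m x (N i m y) = \<omega> (i + 1) m (N i m x) y" if "x \<in> fibre A m" "y \<in> fibre A m" for x y
    using that two_form_skew[OF vb form N_in_fibre[OF that(2)] that(1), of "i + 1" i]
      two_form_skew[OF vb form that] by (simp add: form_N')
  have "\<omega> i m (N i m u) v = \<omega> (i + 1) m (N (i - 1) m (N i m u)) v"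
    using form_N[of "N i m u" m v "i - 1"] u v by (simp add: N_in_fibre)
  also have "\<dots> = \<omega> (i + 1) m (N i m (N (i - 1) m u)) v"
    using N_commute[of u m "i - 1"] u by simp
  also have "\<dots> = \<omega> (i + 1) m (N (i - 1) m u) (N i m v)"
    using u v by (simp add: sym N_in_fibre)
  also have "\<dots> = \<omega> i m u (N i m v)"
    using form_N[of u m "N i m v" "i - 1"] u v by (simp add: N_in_fibre)
  finally show ?thesis
    using two_form_skew[OF vb form u N_in_fibre[OF v], of i i] by simp
qed

text \<open>The given induced tensor on the fibres: sharp of \<open>\<pi> 1\<close> after flat of
  \<open>\<omega> 2\<close> inverts \<open>N 3\<close>, so it is \<open>\<epsilon> 3\<close> times
  \<open>N 3\<close>, and the two factors \<open>\<epsilon> 3\<close> cancel. See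
  \<open>g_flat_eq\<close>.\<close>

definition g :: "'m \<Rightarrow> 'v \<Rightarrow> 'v \<Rightarrow> real" where "g m u v = \<epsilon> 2 * \<omega> 3 m (N 3 m u) v"

lemma form_N_diagonal_step:
  assumes u: "u \<in> fibre A m" and v: "v \<in> fibre A m"
  shows "\<omega> i m (N i m u) v = \<epsilon> (i + 1) * \<omega> (i + 1) m (N (i + 1) m u) v"
proof -
  have "\<omega> i m (N i m u) v = \<omega> (i + 1) m (N (i - 1) m (N i m u)) v"
    using form_N[of "N i m u" m v "i - 1"] u v by (simp add: N_in_fibre)
  also have "\<dots> = \<epsilon> (i + 1) * \<omega> (i + 1) m (N (i + 1) m u) v"
    using N_mult'[of u m "i - 1"] u v by (simp add: N_in_fibre two_form_scaleR[OF vb form])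
  finally show ?thesis .
qed

lemma form_N_diagonal:
  assumes "u \<in> fibre A m" "v \<in> fibre A m"
  shows "\<omega> i m (N i m u) v = \<epsilon> (i - 1) * g m u v"
proof -
  have "\<epsilon> 1 = \<epsilon> 2 * \<epsilon> 3" "\<epsilon> 3 = \<epsilon> 1 * \<epsilon> 2" using sign_prod[of 2] sign_prod[of 1] by simp_all
  moreover have "\<omega> 1 m (N 1 m u) v = \<epsilon> 2 * \<omega> 2 m (N 2 m u) v"
    using form_N_diagonal_step[OF assms, of 1] by simp
  moreover have "\<omega> 2 m (N 2 m u) v = \<epsilon> 3 * \<omega> 3 m (N 3 m u) v"
    using form_N_diagonal_step[OF assms, of 2] by simp
  ultimately show ?thesis
    using exhaust_3[of i] by (auto simp: g_def mult.assoc mult.left_commute)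
qed

text \<open>Composing \<open>g\<close> with \<open>N i\<close> returns to a multiple of the closed
  form \<open>\<omega> i\<close>, which is what the criterion for \<open>g\<close> requires.\<close>

lemma g_N:
  assumes u: "u \<in> fibre A m" and v: "v \<in> fibre A m"
  shows "g m (N i m u) v = \<epsilon> (i + 1) * \<omega> i m u v"
proof -
  have "\<epsilon> (i - 1) * g m (N i m u) v = \<epsilon> i * \<omega> i m u v"
    using form_N_diagonal[of "N i m u" m v i] u v by (simp add: N_in_fibre N_square two_form_scaleR[OF vb form])
  then have "g m (N i m u) v = \<epsilon> (i - 1) * \<epsilon> i * \<omega> i m u v"
    by (metis mult.assoc sign_square(2))
  then show ?thesis using sign_prod[of "i - 1"] by simp
qed

lemma g_form: "g \<in> two_forms A"
proof -
  \<comment> \<open>Skew-symmetry on the diagonal makes \<open>g\<close> alternating.\<close>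
  have "\<omega> 3 m (N 3 m u) u = 0" if "u \<in> fibre A m" for m u
    using form_N_diagonal_skew[OF that that, of 3] by simp
  then show ?thesis
    using smooth_funs_mult[OF vb smooth_funs_const[OF vb] two_form_smooth[OF vb form N_section]]
    by (auto simp: two_forms_def g_def linear_on_set_def two_form_add[OF vb form] two_form_scaleR[OF vb form]
        N_in_fibre N_linear[unfolded linear_on_set_def] fibre_add fibre_scaleR algebra_simps)
qed

section \<open>Compatible pairs and closedness of the induced form\<close>

lemma two_forms_cmult: "\<sigma> \<in> two_forms A \<Longrightarrow> (\<lambda>m u v. c * \<sigma> m u v) \<in> two_forms A"
  using smooth_funs_mult[OF vb smooth_funs_const[OF vb]]
  by (auto simp: two_forms_def linear_on_set_def algebra_simps)

lemma d_two_form_cmult: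
  assumes "\<sigma> \<in> two_forms A" "X \<in> sections A" "Y \<in> sections A" "Z \<in> sections A"
  shows "d_two_form A (\<lambda>m u v. c * \<sigma> m u v) X Y Z m = c * d_two_form A \<sigma> X Y Z m"
  using assms by (simp add: d_two_form_def anchor_deriv_cmult two_form_smooth[OF vb] algebra_simps)

text \<open>Here both forms are closed by hypothesis, so the torsion can be treated before the
  closedness of \<open>g\<close> is known.\<close>

lemma compatible_pred: "compatible_endomorphism A (\<omega> (i - 1)) (\<omega> (i + 1)) (N i)"
  by unfold_locales (simp_all add: form form_N N_endomorphism)

lemma compatible_same: "compatible_endomorphism A (\<omega> i) (\<lambda>m u v. \<epsilon> (i - 1) * g m u v) (N i)"
  by unfold_locales (simp_all add: form g_form two_forms_cmult form_N_diagonal N_endomorphism)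

lemma compatible_g: "compatible_endomorphism A g (\<lambda>m u v. \<epsilon> (i + 1) * \<omega> i m u v) (N i)"
  by unfold_locales (simp_all add: form g_form two_forms_cmult g_N N_endomorphism)

lemma torsion_N:
  assumes "X \<in> sections A" "Y \<in> sections A"
  shows "torsion A (N i) X Y = (\<lambda>m. 0)"
proof -
  interpret symplectic_pair A "\<omega> (i - 1)" "\<pi> (i - 1)" by (rule pair)
  show ?thesis using compatible_pred closed closed N_square assms by (rule torsion_zero)
qed

lemma d_g_N:
  assumes XYZ: "X \<in> sections A" "Y \<in> sections A" "Z \<in> sections A"
  shows "d_two_form A g (\<lambda>x. N i x (X x)) Y Z m = - d_two_form A g X (\<lambda>x. N i x (Y x)) Z m"
proof -
  have "\<epsilon> (i - 1) * d_two_form A g (\<lambda>x. N i x (X x)) Y Z m + \<epsilon> (i - 1) * d_two_form A g X (\<lambda>x. N i x (Y x)) Z m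
      = \<omega> i m 0 (Z m)"
    using compatible_endomorphism.torsion_identity[OF compatible_same N_square XYZ, of i m] XYZ
    by (simp add: torsion_N d_two_form_cmult[OF g_form] closed N_section)
  also have "\<dots> = 0"
    using two_form_scaleR(1)[OF vb form section_in_fibre[OF XYZ(3)] section_in_fibre[OF XYZ(3)], of i m 0] by simp
  finally have "\<epsilon> (i - 1) * (d_two_form A g (\<lambda>x. N i x (X x)) Y Z m + d_two_form A g X (\<lambda>x. N i x (Y x)) Z m) = 0"
    by (simp add: distrib_left)
  then show ?thesis using sign_cases[of "i - 1"] by auto
qed

lemma d_g:
  assumes X: "X \<in> sections A" and Y: "Y \<in> sections A" and Z: "Z \<in> sections A"
  shows "d_two_form A g X Y Z m = 0"
proof -
  have "d_two_form A g X Y Z m = d_two_form A g (\<lambda>x. N 3 x (N 2 x (N 1 x (X x)))) Y Z m"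
    using N_cyclic[of _ _ 1] X by (simp add: section_in_fibre)
  \<comment> \<open>The outermost factor moves first, so the order is reversed on \<open>Y\<close>;
    three moves give the sign \<open>-1\<close>.\<close>
  also have "\<dots> = - d_two_form A g X (\<lambda>x. N 1 x (N 2 x (N 3 x (Y x)))) Z m"
    using X Y Z by (simp add: d_g_N N_section)
  also have "\<dots> = - d_two_form A g X Y Z m"
    using N_cyclic'[of _ _ 1] Y by (simp add: section_in_fibre)
  finally show ?thesis by simp
qed

lemma g_flat_eq:
  assumes v: "v \<in> fibre A m"
  shows "g_flat A \<omega> \<pi> \<epsilon> m v = flat A g m v"
proof -
  interpret symplectic_pair A "\<omega> 1" "\<pi> 1" by (rule pair)
  let ?v = "sharp A (\<pi> 1) m (flat A (\<omega> 2) m v)"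
  have v': "?v \<in> fibre A m" by (rule sharp_in_fibre[OF flat_dual[OF vb form v]])
  have "?v = \<epsilon> 3 *\<^sub>R N 3 m v"
  proof (rule eqI[of _ m _ 1])
    fix w assume w: "w \<in> fibre A m"
    show "\<omega> 1 m ?v w = \<omega> 1 m (\<epsilon> 3 *\<^sub>R N 3 m v) w"
      using two_form_sharp[OF flat_dual[OF vb form v] w, of 2] form_N'[OF v w, of 3] v w
      by (simp add: flat_def two_form_scaleR[OF vb form] N_in_fibre)
  qed (simp_all add: v v' N_in_fibre fibre_scaleR)
  then show ?thesis
    using v by (auto simp: g_flat_def flat_def g_def two_form_scaleR[OF vb form] N_in_fibre mult_ac)
qed

section \<open>The inverse bivector field of the induced form\<close>

lemma g_nondegenerate: "nondegenerate_form A g"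
proof unfold_locales
  fix m v assume v: "v \<in> fibre A m" and *: "\<And>w. w \<in> fibre A m \<Longrightarrow> g m v w = 0"
  have zero: "0 \<in> fibre A m" by (rule subspace_0[OF subspace_fibre[OF vb]])
  have "N 3 m v = 0"
  proof (rule eqI[of _ m _ 3])
    fix w assume w: "w \<in> fibre A m"
    show "\<omega> 3 m (N 3 m v) w = \<omega> 3 m 0 w"
      using form_N_diagonal[OF v w, of 3] *[OF w] two_form_scaleR(1)[OF vb form v w, of 3 0] by simp
  qed (simp_all add: v N_in_fibre zero)
  then have "N 3 m (0 *\<^sub>R v) = \<epsilon> 3 *\<^sub>R v"
    using N_square[OF v, of 3] by simp
  then show "v = 0"
    using N_scaleR[OF v, of 3 0] sign_square(1)[of 3] by (auto simp del: sign_square)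
qed (simp_all add: g_form vb)

text \<open>Explicit inverse of the flat map of \<open>g\<close>: invert \<open>\<epsilon> 2\<close>
  times flat of \<open>\<omega> 3\<close> after \<open>N 3\<close>, the inverse of
  \<open>N 3\<close> being \<open>\<epsilon> 3\<close> times \<open>N 3\<close>.\<close>

definition g_sharp :: "'m \<Rightarrow> ('v \<Rightarrow> real) \<Rightarrow> 'v" where
  "g_sharp m \<xi> = (\<epsilon> 2 * \<epsilon> 3) *\<^sub>R N 3 m (sharp A (\<pi> 3) m \<xi>)"

lemma g_pair: "symplectic_pair A g (g_inv A \<omega> \<pi> \<epsilon>)"
proof -
  interpret nondegenerate_form A g by (rule g_nondegenerate)
  interpret s: symplectic_pair A "\<omega> 3" "\<pi> 3" by (rule pair)
  let ?G = "g_inv A \<omega> \<pi> \<epsilon>"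
  have sharp_fibre: "g_sharp m \<xi> \<in> fibre A m" if "\<xi> \<in> fibre_dual A m" for m \<xi>
    using that by (simp add: g_sharp_def fibre_scaleR N_in_fibre s.sharp_in_fibre)
  have g_pairing: "g m (g_sharp m \<xi>) w = \<xi> w" if "\<xi> \<in> fibre_dual A m" "w \<in> fibre A m" for m \<xi> w
    using that s.sharp_in_fibre[OF that(1)] s.two_form_sharp[OF that]
    by (simp add: g_sharp_def two_form_scaleR[OF vb g_form] N_in_fibre g_def N_square N_scaleR fibre_scaleR
        two_form_scaleR[OF vb form] mult_ac)
  have flat_sharp: "flat A g m (g_sharp m \<xi>) = \<xi>" if "\<xi> \<in> fibre_dual A m" for m \<xi>
    using that by (auto simp: flat_def g_pairing fibre_dual_def)
  have sharp_flat: "g_sharp m (flat A g m v) = v" if v: "v \<in> fibre A m" for m v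
    using v flat_dual[OF vb g_form v]
    by (intro nondegenerate_eqI) (auto simp: sharp_fibre g_pairing flat_def)
  have G: "?G m \<xi> \<eta> = \<eta> (g_sharp m \<xi>)" if "\<xi> \<in> fibre_dual A m" for m \<xi> \<eta>
  proof -
    have "inj_on (g_flat A \<omega> \<pi> \<epsilon> m) (fibre A m)"
      by (rule inj_on_inverseI[of _ "g_sharp m"]) (simp add: g_flat_eq sharp_flat)
    then have "inv_into (fibre A m) (g_flat A \<omega> \<pi> \<epsilon> m) \<xi> = g_sharp m \<xi>"
      using that by (intro inv_into_f_eq) (auto simp: sharp_fibre g_flat_eq flat_sharp)
    then show ?thesis by (simp add: g_inv_def)
  qed
  have sharp_G: "sharp A ?G m \<xi> = g_sharp m \<xi>" if "\<xi> \<in> fibre_dual A m" for m \<xi>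
    using that by (intro sharp_eqI) (simp_all add: sharp_fibre G)
  obtain n :: nat and U V where UV: "\<And>k. k < n \<Longrightarrow> U k \<in> sections A" "\<And>k. k < n \<Longrightarrow> V k \<in> sections A"
    "\<And>m \<xi> \<eta>. \<xi> \<in> fibre_dual A m \<Longrightarrow> \<eta> \<in> fibre_dual A m \<Longrightarrow> \<pi> 3 m \<xi> \<eta> = (\<Sum>k<n. \<xi> (U k m) * \<eta> (V k m))"
    by (rule bivector_expansion[OF vb s.bivector]) (rule that)
  \<comment> \<open>An expansion of \<open>\<pi> 3\<close> becomes one of the inverse of
    \<open>g\<close> by applying \<open>\<epsilon> 2 * \<epsilon> 3\<close> times \<open>N 3\<close>
    to the second factors. Its skew-symmetry is that of \<open>g\<close>.\<close>
  have "?G \<in> bivector_fields A"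
  proof (rule bivector_fieldsI[OF vb])
    fix k assume k: "k < n"
    show "U k \<in> sections A" by (rule UV(1)[OF k])
    show "(\<lambda>m. (\<epsilon> 2 * \<epsilon> 3) *\<^sub>R N 3 m (V k m)) \<in> sections A"
      by (rule sections_scaleR[OF vb smooth_funs_const[OF vb] N_section[OF UV(2)[OF k]]])
  next
    fix m \<xi> \<eta> assume dual: "\<xi> \<in> fibre_dual A m" "\<eta> \<in> fibre_dual A m"
    have "g_sharp m \<xi> = (\<epsilon> 2 * \<epsilon> 3) *\<^sub>R N 3 m (\<Sum>k<n. \<xi> (U k m) *\<^sub>R V k m)"
      using s.sharp_expansion[of n U V m \<xi>] UV dual by (simp add: g_sharp_def)
    also have "\<dots> = (\<Sum>k<n. \<xi> (U k m) *\<^sub>R (\<epsilon> 2 * \<epsilon> 3) *\<^sub>R N 3 m (V k m))"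
      using UV(2) by (subst linear_on_set_sum[OF subspace_fibre[OF vb] N_linear])
        (auto simp: section_in_fibre scaleR_sum_right mult_ac)
    finally have "g_sharp m \<xi> = (\<Sum>k<n. \<xi> (U k m) *\<^sub>R (\<epsilon> 2 * \<epsilon> 3) *\<^sub>R N 3 m (V k m))" .
    moreover have "\<eta> (\<Sum>k<n. \<xi> (U k m) *\<^sub>R (\<epsilon> 2 * \<epsilon> 3) *\<^sub>R N 3 m (V k m))
        = (\<Sum>k<n. \<xi> (U k m) *\<^sub>R \<eta> ((\<epsilon> 2 * \<epsilon> 3) *\<^sub>R N 3 m (V k m)))"
      using UV(2) by (intro linear_on_set_sum[OF subspace_fibre[OF vb] fibre_dual_linear[OF dual(2)]])
        (auto simp: section_in_fibre N_in_fibre fibre_scaleR)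
    ultimately show "?G m \<xi> \<eta> = (\<Sum>k<n. \<xi> (U k m) * \<eta> ((\<epsilon> 2 * \<epsilon> 3) *\<^sub>R N 3 m (V k m)))"
      by (simp add: G dual)
    show "?G m \<eta> \<xi> = - ?G m \<xi> \<eta>"
      using g_pairing[OF dual(1) sharp_fibre[OF dual(2)]] g_pairing[OF dual(2) sharp_fibre[OF dual(1)]]
        two_form_skew[OF vb g_form sharp_fibre[OF dual(1)] sharp_fibre[OF dual(2)]]
      by (simp add: G dual)
  qed
  then have "inverse_bivector A g ?G"
    by (simp add: inverse_bivector_def sharp_G flat_sharp sharp_flat flat_dual[OF vb g_form])
  then show ?thesis by unfold_locales
qed

lemma PN_structure_form: "PN_structure A (\<pi> i) (N i)"
proof -
  interpret symplectic_pair A "\<omega> i" "\<pi> i" by (rule pair)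
  show ?thesis
    by (rule PN_structure_of_closed[OF compatible_same closed _ N_square])
       (simp_all add: d_two_form_cmult[OF g_form] d_g)
qed

lemma PN_structure_g: "PN_structure A (g_inv A \<omega> \<pi> \<epsilon>) (N i)"
proof -
  interpret symplectic_pair A g "g_inv A \<omega> \<pi> \<epsilon>" by (rule g_pair)
  show ?thesis
    by (rule PN_structure_of_closed[OF compatible_g d_g _ N_square])
       (simp_all add: d_two_form_cmult[OF form] closed)
qed

end

theorem corollary5p7:
  fixes A :: "('m::{t2_space,second_countable_topology}, 'e::real_normed_vector, 'v::real_vector,
               'f::real_normed_vector) lie_algebroid"
    and \<omega> :: "3 \<Rightarrow> 'm \<Rightarrow> 'v \<Rightarrow> 'v \<Rightarrow> real"
    and \<pi> :: "3 \<Rightarrow> 'm \<Rightarrow> ('v \<Rightarrow> real) \<Rightarrow> ('v \<Rightarrow> real) \<Rightarrow> real"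
    and \<epsilon> :: "3 \<Rightarrow> real"
  assumes "lie_algebroid A"
    and "hypersymplectic A \<omega> \<pi> \<epsilon>"
    and "\<epsilon> 1 * \<epsilon> 2 * \<epsilon> 3 = 1"
  shows "\<forall>i. PN_structure A (\<pi> i) (transition A \<omega> \<pi> i) \<and>
             PN_structure A (g_inv A \<omega> \<pi> \<epsilon>) (transition A \<omega> \<pi> i)"
proof -
  interpret skew_algebroid A
    by (rule skew_algebroid_of_lie_algebroid[OF assms(1)])
  interpret commuting_hypersymplectic A \<omega> \<pi> \<epsilon>
    using assms(2,3) by unfold_locales
  show ?thesis
    by (simp add: PN_structure_form PN_structure_g)
qed

end
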